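(* Let $A$ be a regular weak multiplier Hopf algebra with a faithful left cointegral $h\in A$. Then $A$ is quasi-Frobenius.
   Context: All algebras are over $\mathbb{C}$, associative, possibly non-unital, with non-degenerate product. $A$ is idempotent if $A^2=A$; $M(A)$ is the multiplier algebra (identity $1$); $A'$ is the space of all linear functionals on $A$. A coproduct is a homomorphism $\Delta:A\to M(A\otimes A)$ with $\Delta(a)(1\otimes b),(a\otimes 1)\Delta(b)\in A\otimes A$, coassociative: $(a\otimes1\otimes1)(\Delta\otimes id)(\Delta(b)(1\otimes c))=(id\otimes\Delta)((a\otimes1)\Delta(b))(1\otimes1\otimes c)$. Put $T_1(a\otimes b)=\Delta(a)(1\otimes b)$, $T_2(a\otimes b)=(a\otimes1)\Delta(b)$. $\Delta$ is full if the smallest subspaces $V,W\subset A$ with $\Delta(A)(1\otimes A)\subset V\otimes A$ and $(A\otimes1)\Delta(A)\subset A\otimes W$ both equal $A$. A counit is a linear functional $\varepsilon$ with $(\varepsilon\otimes id)(\Delta(a)(1\otimes b))=ab$, $(id\otimes\varepsilon)((c\otimes1)\Delta(a))=ca$. A weak multiplier Hopf algebra is a non-degenerate idempotent algebra $A$ with a full coproduct $\Delta$ and a counit such that: (i) there is an idempotent $E\in M(A\otimes A)$ with $T_1(A\otimes A)=E(A\otimes A)$, $T_2(A\otimes A)=(A\otimes A)E$; (ii) $(id\otimes\Delta)E=(E\otimes1)(1\otimes E)=(1\otimes E)(E\otimes1)$; (iii) $\mathrm{Ker}(T_i)=(1-G_i)(A\otimes A)$, $i=1,2$, where $G_1,G_2$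 are the linear maps on $A\otimes A$ given by $(G_1\otimes id)(\Delta_{13}(a)(1\otimes b\otimes c))=\Delta_{13}(a)(1\otimes E)(1\otimes b\otimes c)$ and $(id\otimes G_2)((a\otimes b\otimes1)\Delta_{13}(c))=(a\otimes b\otimes1)(E\otimes1)\Delta_{13}(c)$. Here $\Delta$ (and likewise $id\otimes\Delta$) is uniquely extended to multipliers, with $\Delta(1)=E$. With Sweedler notation $\Delta(a)=\sum a_{(1)}\otimes a_{(2)}$, the antipode $S$ is the non-degenerate anti-homomorphism $A\to M(A)$ with $E(a\otimes b)=\sum a_{(1)}\otimes a_{(2)}S(a_{(3)})b$, $(a\otimes b)E=\sum aS(b_{(1)})b_{(2)}\otimes b_{(3)}$, $G_1(a\otimes b)=\sum a_{(1)}\otimes S(a_{(2)})a_{(3)}b$, $G_2(a\otimes b)=\sum ab_{(1)}S(b_{(2)})\otimes b_{(3)}$, $\sum S(a_{(1)})a_{(2)}S(a_{(3)})=S(a)$; it extends to $M(A)$. $A$ is regular if $S$ is bijective from $A$ to $A$; then also $\Delta(a)(b\otimes1),(1\otimes a)\Delta(b)\in A\otimes A$. Put $\varepsilon_t(a)=\sum a_{(1)}S(a_{(2)})$. For $f\in A'$, $(id\otimes f)\Delta(a)$ and $(f\otimes id)\Delta(a)$ are the elements of $M(A)$ defined by slicing after multiplying, on either side, by $b\otimes1$, resp. $1\otimes b$, $b\in A$. A left cointegral is a non-zero $h\in M(A)$ with $ah=\varepsilon_t(a)h$ for all $a\in A$. It is faithful if for $f\in A'$, $(id\otimes f)\Delta(h)=0$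 or $(f\otimes id)\Delta(h)=0$ implies $f=0$. For a subset $I\subset A$, $r(I)=\{a\in A: Ia=0\}$ is the right annihilator and $l(I)=\{a\in A:aI=0\}$ the left annihilator. $A$ is quasi-Frobenius if $l(r(I))=I$ for every left ideal $I$ and $r(l(J))=J$ for every right ideal $J$. *)

theory Defs
  imports Complex_Main "HOL-Library.Poly_Mapping"
begin

section \<open>Complex vector spaces and (possibly non-unital) complex algebras\<close>

class scaleC =
  fixes scaleC :: "complex \<Rightarrow> 'a \<Rightarrow> 'a"  (infixr \<open>*\<^sub>C\<close> 75)

class cvector_space = scaleC + ab_group_add +
  assumes scaleC_add_right: "c *\<^sub>C (x + y) = c *\<^sub>C x + c *\<^sub>C y"
    and scaleC_add_left: "(c + d) *\<^sub>C x = c *\<^sub>C x + d *\<^sub>C x"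
    and scaleC_scaleC [simp]: "c *\<^sub>C d *\<^sub>C x = (c * d) *\<^sub>C x"
    and scaleC_one [simp]: "1 *\<^sub>C x = x"

class calgebra = cvector_space + ring +
  assumes mult_scaleC_left [simp]: "c *\<^sub>C x * y = c *\<^sub>C (x * y)"
    and mult_scaleC_right [simp]: "x * c *\<^sub>C y = c *\<^sub>C (x * y)"

global_interpretation cvec: vector_space "scaleC :: complex \<Rightarrow> 'a \<Rightarrow> 'a::cvector_space"
  by unfold_locales (simp_all add: scaleC_add_right scaleC_add_left)

abbreviation clinear :: "('a::cvector_space \<Rightarrow> 'b::cvector_space) \<Rightarrow> bool"
  where "clinear \<equiv> Vector_Spaces.linear scaleC scaleC"

lemma clinear_iff:
  "clinear f \<longleftrightarrow> (\<forall>x y. f (x + y) = f x + f y) \<and> (\<forall>c x. f (c *\<^sub>C x) = c *\<^sub>C f x)"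
  by (auto simp: Vector_Spaces.linear_def module_hom_def module_hom_axioms_def
      cvec.vector_space_axioms cvec.module_axioms)

lemma clinearD:
  assumes "clinear f"
  shows "f (x + y) = f x + f y" "f (c *\<^sub>C x) = c *\<^sub>C f x" "f 0 = 0" "f (- x) = - f x"
    "f (x - y) = f x - f y"
proof -
  show 1: "f (x + y) = f x + f y" and 2: "f (c *\<^sub>C x) = c *\<^sub>C f x" for x y c
    using assms by (auto simp: clinear_iff)
  show 3: "f 0 = 0" using 2[of 0 0] by simp
  show 4: "f (- x) = - f x" for x
    using 1[of x "- x"] 3 by (simp add: eq_neg_iff_add_eq_0 add.commute)
  show "f (x - y) = f x - f y" using 1[of x "- y"] 4[of y] by simp
qed

lemma clinearI:
  "(\<And>x y. f (x + y) = f x + f y) \<Longrightarrow> (\<And>c x. f (c *\<^sub>C x) = c *\<^sub>C f x) \<Longrightarrow> clinear f"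
  by (simp add: clinear_iff)

lemma clinear_comp: "clinear f \<Longrightarrow> clinear g \<Longrightarrow> clinear (\<lambda>x. f (g x))"
  by (simp add: clinear_iff)

lemma clinear_id: "clinear (\<lambda>x. x)"
  by (simp add: clinear_iff)

definition cbilinear :: "('a::cvector_space \<Rightarrow> 'b::cvector_space \<Rightarrow> 'c::cvector_space) \<Rightarrow> bool"
  where "cbilinear \<beta> \<longleftrightarrow> (\<forall>a. clinear (\<beta> a)) \<and> (\<forall>b. clinear (\<lambda>a. \<beta> a b))"

instantiation complex :: calgebra
begin
definition scaleC_complex_def [simp]: "scaleC c (x :: complex) = c * x"
instance by standard (simp_all add: algebra_simps)
end

instantiation poly_mapping :: (type, cvector_space) cvector_space
begin
definition scaleC_poly_mapping_def: "scaleC c f = Poly_Mapping.map (scaleC c) f"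
  for f :: "'a \<Rightarrow>\<^sub>0 'b"
lemma lookup_scaleC: "Poly_Mapping.lookup (c *\<^sub>C f) k = c *\<^sub>C Poly_Mapping.lookup f k"
  for f :: "'a \<Rightarrow>\<^sub>0 'b"
  by (cases "Poly_Mapping.lookup f k = 0") (simp_all add: scaleC_poly_mapping_def Poly_Mapping.map.rep_eq)
instance
  by standard (auto intro!: poly_mapping_eqI
      simp: lookup_scaleC lookup_add scaleC_add_right scaleC_add_left)
end


section \<open>The tensor product\<close>

text \<open>
  \<open>A \<otimes> B\<close> is the free vector space on \<open>A \<times> B\<close> modulo the span of the bilinearity relations.
\<close>

definition tensor_relations :: "('a::cvector_space \<times> 'b::cvector_space \<Rightarrow>\<^sub>0 complex) set" where
  "tensor_relations =
    {Poly_Mapping.single (a + a', b) 1 - Poly_Mapping.single (a, b) 1 - Poly_Mapping.single (a', b) 1 |a a' b. True} \<union>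
    {Poly_Mapping.single (a, b + b') 1 - Poly_Mapping.single (a, b) 1 - Poly_Mapping.single (a, b') 1 |a b b'. True} \<union>
    {Poly_Mapping.single (c *\<^sub>C a, b) 1 - c *\<^sub>C Poly_Mapping.single (a, b) 1 |c a b. True} \<union>
    {Poly_Mapping.single (a, c *\<^sub>C b) 1 - c *\<^sub>C Poly_Mapping.single (a, b) 1 |c a b. True}"

definition tensor_rel ::
  "('a::cvector_space \<times> 'b::cvector_space \<Rightarrow>\<^sub>0 complex) \<Rightarrow> ('a \<times> 'b \<Rightarrow>\<^sub>0 complex) \<Rightarrow> bool"
  where "tensor_rel x y \<longleftrightarrow> x - y \<in> cvec.span tensor_relations"

quotient_type (overloaded) ('a, 'b) tensor (infixr \<open>\<otimes>\<close> 71) =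
  "'a::cvector_space \<times> 'b::cvector_space \<Rightarrow>\<^sub>0 complex" / tensor_rel
proof (rule equivpI)
  show "reflp tensor_rel" by (auto intro!: reflpI simp: tensor_rel_def cvec.span_zero)
  show "symp tensor_rel"
  proof (rule sympI)
    fix x y assume "tensor_rel x y"
    then show "tensor_rel y x"
      unfolding tensor_rel_def using cvec.span_neg[of "x - y"] by simp
  qed
  show "transp tensor_rel"
  proof (rule transpI)
    fix x y z assume "tensor_rel x y" "tensor_rel y z"
    then show "tensor_rel x z"
      unfolding tensor_rel_def using cvec.span_add[of "x - y" _ "y - z"] by simp
  qed
qed

lift_definition pure_tensor :: "'a::cvector_space \<Rightarrow> 'b::cvector_space \<Rightarrow> 'a \<otimes> 'b"  (infixr \<open>\<otimes>\<close> 71)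
  is "\<lambda>a b. Poly_Mapping.single (a, b) 1" .

instantiation tensor :: (cvector_space, cvector_space) cvector_space
begin

lift_definition zero_tensor :: "'a \<otimes> 'b" is 0 .

lift_definition plus_tensor :: "'a \<otimes> 'b \<Rightarrow> 'a \<otimes> 'b \<Rightarrow> 'a \<otimes> 'b" is "(+)"
  unfolding tensor_rel_def using cvec.span_add by (fastforce simp: algebra_simps)

lift_definition uminus_tensor :: "'a \<otimes> 'b \<Rightarrow> 'a \<otimes> 'b" is uminus
  unfolding tensor_rel_def using cvec.span_neg by fastforce

lift_definition minus_tensor :: "'a \<otimes> 'b \<Rightarrow> 'a \<otimes> 'b \<Rightarrow> 'a \<otimes> 'b" is "(-)"
  unfolding tensor_rel_def using cvec.span_diff by (fastforce simp: algebra_simps)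

lift_definition scaleC_tensor :: "complex \<Rightarrow> 'a \<otimes> 'b \<Rightarrow> 'a \<otimes> 'b" is "scaleC"
  unfolding tensor_rel_def cvec.scale_right_diff_distrib[symmetric] by (rule cvec.span_scale)

instance
  by (standard; transfer)
    (simp_all add: tensor_rel_def cvec.span_zero scaleC_add_right scaleC_add_left)

end

lemma tensor_relD:
  assumes "x - y \<in> tensor_relations" shows "tensor_rel x y"
  using assms by (simp add: tensor_rel_def cvec.span_base)

lemma tensor_add_left: "(a + a') \<otimes> b = a \<otimes> b + a' \<otimes> b"
  by transfer (rule tensor_relD, unfold tensor_relations_def diff_diff_add[symmetric], blast)

lemma tensor_add_right: "a \<otimes> (b + b') = a \<otimes> b + a \<otimes> b'"
  by transfer (rule tensor_relD, unfold tensor_relations_def diff_diff_add[symmetric], blast)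

lemma tensor_scaleC_left: "(c *\<^sub>C a) \<otimes> b = c *\<^sub>C (a \<otimes> b)"
  by transfer (rule tensor_relD, unfold tensor_relations_def, blast)

lemma tensor_scaleC_right: "a \<otimes> (c *\<^sub>C b) = c *\<^sub>C (a \<otimes> b)"
  by transfer (rule tensor_relD, unfold tensor_relations_def, blast)

lemma cbilinear_pure_tensor: "cbilinear (\<otimes>)"
  by (simp add: cbilinear_def clinear_iff tensor_add_left tensor_add_right
      tensor_scaleC_left tensor_scaleC_right)

lemma tensor_zero [simp]: "0 \<otimes> b = 0" "a \<otimes> 0 = 0"
  using tensor_scaleC_left[of 0 0 b] tensor_scaleC_right[of a 0 0] by simp_all

text \<open>Meaningful for bilinear \<open>\<beta>\<close> only.\<close>

definition tensor_lift ::
  "('a::cvector_space \<Rightarrow> 'b::cvector_space \<Rightarrow> 'c::cvector_space) \<Rightarrow> 'a \<otimes> 'b \<Rightarrow> 'c"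
  where "tensor_lift \<beta> = (THE g. clinear g \<and> (\<forall>a b. g (a \<otimes> b) = \<beta> a b))"

lemma clinear_lookup_sum:
  "clinear (\<lambda>x. \<Sum>k\<in>Poly_Mapping.keys x. Poly_Mapping.lookup x k *\<^sub>C g k)" (is "clinear ?F")
  for g :: "'k \<Rightarrow> 'v::cvector_space"
proof -
  have F: "?F x = (\<Sum>k\<in>K. Poly_Mapping.lookup x k *\<^sub>C g k)" if "finite K" "Poly_Mapping.keys x \<subseteq> K" for x K
    using that by (intro sum.mono_neutral_left) (auto simp: in_keys_iff)
  show ?thesis
  proof (rule clinearI)
    fix x y :: "'k \<Rightarrow>\<^sub>0 complex"
    have "Poly_Mapping.keys (x + y) \<subseteq> Poly_Mapping.keys x \<union> Poly_Mapping.keys y"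
      by (rule keys_add)
    then show "?F (x + y) = ?F x + ?F y"
      by (subst (1 2 3) F[of "Poly_Mapping.keys x \<union> Poly_Mapping.keys y"])
        (simp_all add: lookup_add scaleC_add_left sum.distrib)
  next
    fix c and x :: "'k \<Rightarrow>\<^sub>0 complex"
    have "Poly_Mapping.keys (c *\<^sub>C x) \<subseteq> Poly_Mapping.keys x"
      by (auto simp: in_keys_iff lookup_scaleC)
    then show "?F (c *\<^sub>C x) = c *\<^sub>C ?F x"
      by (subst F[of "Poly_Mapping.keys x"]) (simp_all add: lookup_scaleC cvec.scale_sum_right)
  qed
qed

lemma clinear_abs_tensor: "clinear abs_tensor"
  by (rule clinearI) (simp_all add: plus_tensor.abs_eq scaleC_tensor.abs_eq)

lemma clinear_sum: "clinear f \<Longrightarrow> f (sum g K) = (\<Sum>k\<in>K. f (g k))"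
  by (induction K rule: infinite_finite_induct) (simp_all add: clinearD)

lemma poly_mapping_expand:
  "x = (\<Sum>k\<in>Poly_Mapping.keys x. Poly_Mapping.lookup x k *\<^sub>C Poly_Mapping.single k 1)"
  for x :: "'k \<Rightarrow>\<^sub>0 complex"
proof (rule poly_mapping_eqI)
  fix j
  have "Poly_Mapping.lookup (\<Sum>k\<in>Poly_Mapping.keys x. Poly_Mapping.lookup x k *\<^sub>C Poly_Mapping.single k 1) j
      = (\<Sum>k\<in>Poly_Mapping.keys x. if j = k then Poly_Mapping.lookup x k else 0)"
    by (intro trans[OF lookup_sum] sum.cong) (auto simp: lookup_scaleC lookup_single when_def)
  then show "Poly_Mapping.lookup x j = Poly_Mapping.lookup (\<Sum>k\<in>Poly_Mapping.keys x. Poly_Mapping.lookup x k *\<^sub>C Poly_Mapping.single k 1) j"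
    by (simp add: in_keys_iff)
qed

lemma abs_tensor_surj: obtains y where "x = abs_tensor y"
  by (induction x rule: tensor.abs_induct) auto

lemma tensor_expand:
  fixes x :: "'a::cvector_space \<otimes> 'b::cvector_space"
  obtains K :: "('a \<times> 'b) set" and c where "finite K" "x = (\<Sum>k\<in>K. c k *\<^sub>C (fst k \<otimes> snd k))"
proof -
  obtain y where x: "x = abs_tensor y" by (rule abs_tensor_surj)
  have "abs_tensor (Poly_Mapping.single k 1) = fst k \<otimes> snd k" for k :: "'a \<times> 'b"
    by (cases k) (simp add: pure_tensor.abs_eq)
  then have "x = (\<Sum>k\<in>Poly_Mapping.keys y. Poly_Mapping.lookup y k *\<^sub>C (fst k \<otimes> snd k))"
    unfolding x by (subst poly_mapping_expand)
      (simp add: clinear_sum[OF clinear_abs_tensor] clinearD[OF clinear_abs_tensor])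
  then show ?thesis using that[of "Poly_Mapping.keys y"] by simp
qed

lemma tensor_induct [case_names pure add]:
  assumes pure: "\<And>a b. P (a \<otimes> b)" and add: "\<And>x y. P x \<Longrightarrow> P y \<Longrightarrow> P (x + y)"
  shows "P x"
proof -
  obtain K c where K: "finite K" and x: "x = (\<Sum>k\<in>K. c k *\<^sub>C (fst k \<otimes> snd k))"
    by (rule tensor_expand)
  have 0: "P 0" using pure[of 0 0] by simp
  have *: "P (c k *\<^sub>C (fst k \<otimes> snd k))" for k
    using pure[of "c k *\<^sub>C fst k" "snd k"] by (simp add: tensor_scaleC_left)
  from K show ?thesis unfolding x
    by (induction K rule: finite_induct) (simp_all add: 0 add *)
qed

lemma tensor_ext:
  assumes "clinear f" "clinear g" "\<And>a b. f (a \<otimes> b) = g (a \<otimes> b)"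
  shows "f x = g x"
  using assms by (induction x rule: tensor_induct) (simp_all add: clinearD)

lemma tensor_lift:
  assumes "cbilinear \<beta>"
  shows "clinear (tensor_lift \<beta>)" "tensor_lift \<beta> (a \<otimes> b) = \<beta> a b"
proof -
  define F where "F x = (\<Sum>k\<in>Poly_Mapping.keys x. Poly_Mapping.lookup x k *\<^sub>C case_prod \<beta> k)" for x :: "'a \<times> 'b \<Rightarrow>\<^sub>0 complex"
  have F: "clinear F" unfolding F_def by (rule clinear_lookup_sum)
  have F1: "F (Poly_Mapping.single (a, b) 1) = \<beta> a b" for a b by (simp add: F_def)
  have \<beta>: "\<beta> (a + a') b = \<beta> a b + \<beta> a' b" "\<beta> a (b + b') = \<beta> a b + \<beta> a b'"
    "\<beta> (c *\<^sub>C a) b = c *\<^sub>C \<beta> a b" "\<beta> a (c *\<^sub>C b) = c *\<^sub>C \<beta> a b" for a a' b b' c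
    using assms by (auto simp: cbilinear_def clinear_iff)
  have F0: "F x = 0" if "x \<in> cvec.span tensor_relations" for x
    using that
  proof (induction rule: cvec.span_induct_alt)
    case (step c x y)
    then have "F x = 0"
      by (auto simp: tensor_relations_def clinearD[OF F] F1 \<beta>)
    then show ?case using step by (simp add: clinearD[OF F])
  qed (simp add: clinearD[OF F])
  define g where "g x = F (rep_tensor x)" for x
  have g: "g (abs_tensor y) = F y" for y
  proof -
    have "tensor_rel (rep_tensor (abs_tensor y)) y"
      by (rule Quotient3_rep_abs[OF Quotient3_tensor]) (simp add: tensor_rel_def cvec.span_zero)
    then have "F (rep_tensor (abs_tensor y) - y) = 0" by (intro F0) (simp add: tensor_rel_def)
    then show ?thesis by (simp add: g_def clinearD[OF F])
  qed
  have "clinear g"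
  proof (rule clinearI)
    fix x y :: "'a \<otimes> 'b"
    obtain x' y' where "x = abs_tensor x'" "y = abs_tensor y'" by (metis abs_tensor_surj)
    then show "g (x + y) = g x + g y"
      by (simp add: g clinearD(1)[OF clinear_abs_tensor, symmetric] clinearD[OF F])
  next
    fix c and x :: "'a \<otimes> 'b"
    obtain x' where "x = abs_tensor x'" by (rule abs_tensor_surj)
    then show "g (c *\<^sub>C x) = c *\<^sub>C g x"
      by (simp add: g clinearD(2)[OF clinear_abs_tensor, symmetric] clinearD[OF F])
  qed
  moreover have "g (a \<otimes> b) = \<beta> a b" for a b
    by (simp add: pure_tensor.abs_eq g F1)
  ultimately have "\<exists>!g. clinear g \<and> (\<forall>a b. g (a \<otimes> b) = \<beta> a b)"
  proof (intro ex1I[of _ g] conjI allI)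
    fix g' assume *: "clinear g' \<and> (\<forall>a b. g' (a \<otimes> b) = \<beta> a b)"
    show "g' = g"
      by (rule ext, rule tensor_ext) (simp_all add: * \<open>clinear g\<close> \<open>\<And>a b. g (a \<otimes> b) = \<beta> a b\<close>)
  qed
  then have *: "clinear (tensor_lift \<beta>) \<and> (\<forall>a b. tensor_lift \<beta> (a \<otimes> b) = \<beta> a b)"
    unfolding tensor_lift_def by (rule theI')
  show "clinear (tensor_lift \<beta>)" "tensor_lift \<beta> (a \<otimes> b) = \<beta> a b"
    using * by blast+
qed

definition tensor_map ::
  "('a::cvector_space \<Rightarrow> 'c::cvector_space) \<Rightarrow> ('b::cvector_space \<Rightarrow> 'd::cvector_space) \<Rightarrow> 'a \<otimes> 'b \<Rightarrow> 'c \<otimes> 'd"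
  where "tensor_map f g = tensor_lift (\<lambda>a b. f a \<otimes> g b)"

lemma tensor_map:
  assumes "clinear f" "clinear g"
  shows "clinear (tensor_map f g)" "tensor_map f g (a \<otimes> b) = f a \<otimes> g b"
proof -
  have "cbilinear (\<lambda>a b. f a \<otimes> g b)"
    using assms by (simp add: cbilinear_def clinear_iff tensor_add_left tensor_add_right
        tensor_scaleC_left tensor_scaleC_right)
  from tensor_lift[OF this] show "clinear (tensor_map f g)" "tensor_map f g (a \<otimes> b) = f a \<otimes> g b"
    by (simp_all add: tensor_map_def)
qed

definition tensor_swap :: "'a::cvector_space \<otimes> 'b::cvector_space \<Rightarrow> 'b \<otimes> 'a"
  where "tensor_swap = tensor_lift (\<lambda>a b. b \<otimes> a)"

lemma tensor_swap: "clinear tensor_swap" "tensor_swap (a \<otimes> b) = b \<otimes> a"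
proof -
  have "cbilinear (\<lambda>a b. b \<otimes> a)"
    by (simp add: cbilinear_def clinear_iff tensor_add_left tensor_add_right
        tensor_scaleC_left tensor_scaleC_right)
  from tensor_lift[OF this] show "clinear tensor_swap" "tensor_swap (a \<otimes> b) = b \<otimes> a"
    by (simp_all add: tensor_swap_def)
qed

definition tensor_assoc ::
  "('a::cvector_space \<otimes> 'b::cvector_space) \<otimes> 'c::cvector_space \<Rightarrow> 'a \<otimes> 'b \<otimes> 'c"
  where "tensor_assoc = tensor_lift (\<lambda>x c. tensor_lift (\<lambda>a b. a \<otimes> b \<otimes> c) x)"

definition tensor_assoc_inv ::
  "'a::cvector_space \<otimes> 'b::cvector_space \<otimes> 'c::cvector_space \<Rightarrow> ('a \<otimes> 'b) \<otimes> 'c"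
  where "tensor_assoc_inv = tensor_lift (\<lambda>a x. tensor_lift (\<lambda>b c. (a \<otimes> b) \<otimes> c) x)"

lemma tensor_lift_parametric:
  assumes "\<And>c. cbilinear (\<lambda>a b. \<beta> a b c)" "\<And>a b. clinear (\<lambda>c. \<beta> a b c)"
  shows "cbilinear (\<lambda>x c. tensor_lift (\<lambda>a b. \<beta> a b c) x)"
    and "cbilinear (\<lambda>c x. tensor_lift (\<lambda>a b. \<beta> a b c) x)"
proof -
  note L = tensor_lift[OF assms(1)]
  have "clinear (\<lambda>c. tensor_lift (\<lambda>a b. \<beta> a b c) x)" for x
  proof (induction x rule: tensor_induct)
    case (pure a b)
    show ?case using assms(2) by (simp add: L)
  next
    case (add x y)
    then show ?case by (simp add: clinearD[OF L(1)] clinear_iff algebra_simps scaleC_add_right)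
  qed
  then show "cbilinear (\<lambda>x c. tensor_lift (\<lambda>a b. \<beta> a b c) x)"
    "cbilinear (\<lambda>c x. tensor_lift (\<lambda>a b. \<beta> a b c) x)"
    using L(1) by (simp_all add: cbilinear_def)
qed

lemma tensor_assoc:
  "clinear tensor_assoc" "tensor_assoc ((a \<otimes> b) \<otimes> c) = a \<otimes> b \<otimes> c"
  "clinear tensor_assoc_inv" "tensor_assoc_inv (a \<otimes> b \<otimes> c) = (a \<otimes> b) \<otimes> c"
proof -
  note simps = cbilinear_def clinear_iff tensor_add_left tensor_add_right
    tensor_scaleC_left tensor_scaleC_right
  have b1: "\<And>c. cbilinear (\<lambda>a b. a \<otimes> b \<otimes> c)" "\<And>a b. clinear (\<lambda>c. a \<otimes> b \<otimes> c)"
    and b2: "\<And>a. cbilinear (\<lambda>b c. (a \<otimes> b) \<otimes> c)" "\<And>b c. clinear (\<lambda>a. (a \<otimes> b) \<otimes> c)"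
    by (simp_all add: simps)
  show "clinear tensor_assoc" "tensor_assoc ((a \<otimes> b) \<otimes> c) = a \<otimes> b \<otimes> c"
    unfolding tensor_assoc_def by (simp_all add: tensor_lift tensor_lift_parametric(1) b1)
  show "clinear tensor_assoc_inv" "tensor_assoc_inv (a \<otimes> b \<otimes> c) = (a \<otimes> b) \<otimes> c"
    unfolding tensor_assoc_inv_def by (simp_all add: tensor_lift tensor_lift_parametric(2) b2)
qed

instantiation tensor :: (calgebra, calgebra) calgebra
begin

definition times_tensor :: "'a \<otimes> 'b \<Rightarrow> 'a \<otimes> 'b \<Rightarrow> 'a \<otimes> 'b"
  where "x * y = tensor_lift (\<lambda>a b. tensor_map (\<lambda>c. a * c) (\<lambda>d. b * d) y) x"

lemma clinear_mult_left: "clinear (\<lambda>y. a * y)" for a :: "'c::calgebra"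
  by (simp add: clinear_iff algebra_simps)

lemma clinear_mult_right: "clinear (\<lambda>y. y * a)" for a :: "'c::calgebra"
  by (simp add: clinear_iff algebra_simps)

lemma cbilinear_tensor_map_mult:
  "cbilinear (\<lambda>a b. tensor_map (\<lambda>c. a * c) (\<lambda>d. b * d) y)" for y :: "'a \<otimes> 'b"
proof -
  have "clinear (\<lambda>a. tensor_map (\<lambda>c. a * c) (\<lambda>d. b * d) y)"
    "clinear (\<lambda>b. tensor_map (\<lambda>c. a * c) (\<lambda>d. b * d) y)" for a :: 'a and b :: 'b
    by (induction y rule: tensor_induct)
      (simp_all add: tensor_map[OF clinear_mult_left clinear_mult_left]
        clinearD[OF tensor_map(1)[OF clinear_mult_left clinear_mult_left]]
        clinear_iff algebra_simps tensor_add_left tensor_add_right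
        tensor_scaleC_left tensor_scaleC_right scaleC_add_right)
  then show ?thesis by (simp add: cbilinear_def)
qed

lemma cbilinear_times_tensor: "cbilinear (\<lambda>x y. x * y :: 'a \<otimes> 'b)"
  unfolding times_tensor_def
  by (rule tensor_lift_parametric(1)) (rule cbilinear_tensor_map_mult, rule tensor_map(1)[OF clinear_mult_left clinear_mult_left])

lemma times_pure_tensor: "(a \<otimes> b) * (c \<otimes> d) = (a * c) \<otimes> (b * d)" for a c :: 'a and b d :: 'b
  unfolding times_tensor_def
  by (subst tensor_lift(2)[OF cbilinear_tensor_map_mult]) (simp add: tensor_map clinear_mult_left)

instance
proof
  fix x y z :: "'a \<otimes> 'b" and c
  have B: "clinear (\<lambda>y. x * y)" "clinear (\<lambda>x. x * y)" for x y :: "'a \<otimes> 'b"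
    using cbilinear_times_tensor by (auto simp: cbilinear_def)
  note [simp] = clinearD[OF B(1)] clinearD[OF B(2)] times_pure_tensor
  show "(x + y) * z = x * z + y * z" "x * (y + z) = x * y + x * z"
    "c *\<^sub>C x * y = c *\<^sub>C (x * y)" "x * c *\<^sub>C y = c *\<^sub>C (x * y)"
    by simp_all
  show "x * y * z = x * (y * z)"
  proof (induction x rule: tensor_induct)
    case (pure a b)
    show ?case
    proof (induction y rule: tensor_induct)
      case (pure c d)
      show ?case by (induction z rule: tensor_induct) (simp_all add: mult.assoc)
    qed simp
  qed simp
qed

end

lemmas tensor_mult_simps = times_pure_tensor distrib_left distrib_right

lemma tensor_map_mult:
  assumes "clinear f" "clinear g" "\<And>a b. f (a * b) = f a * f b" "\<And>a b. g (a * b) = g a * g b"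
  shows "tensor_map f g (x * y) = tensor_map f g x * tensor_map f g y"
proof (induction x rule: tensor_induct)
  case (pure a b)
  show ?case
    by (induction y rule: tensor_induct)
      (simp_all add: tensor_map assms clinearD[OF tensor_map(1)] tensor_mult_simps)
next
  case (add x y)
  then show ?case by (simp add: tensor_mult_simps assms clinearD[OF tensor_map(1)])
qed

lemma tensor_swap_swap [simp]: "tensor_swap (tensor_swap x) = x"
  by (induction x rule: tensor_induct) (simp_all add: tensor_swap clinearD[OF tensor_swap(1)])

lemma tensor_swap_mult: "tensor_swap (x * y) = tensor_swap x * tensor_swap y"
proof (induction x rule: tensor_induct)
  case (pure a b)
  show ?case
    by (induction y rule: tensor_induct)
      (simp_all add: tensor_swap clinearD[OF tensor_swap(1)] tensor_mult_simps)
next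
  case (add x y)
  then show ?case by (simp add: tensor_mult_simps clinearD[OF tensor_swap(1)])
qed

lemma tensor_map_id: "tensor_map (\<lambda>x. x) (\<lambda>x. x) z = z"
  by (induction z rule: tensor_induct)
    (simp_all add: tensor_map clinear_id clinearD[OF tensor_map(1)[OF clinear_id clinear_id]])

lemma tensor_map_comp:
  assumes "clinear f" "clinear g" "clinear f'" "clinear g'"
  shows "tensor_map f g (tensor_map f' g' x) = tensor_map (\<lambda>x. f (f' x)) (\<lambda>x. g (g' x)) x"
  by (induction x rule: tensor_induct)
    (simp_all add: tensor_map assms clinear_comp clinearD[OF tensor_map(1)])

lemma tensor_assoc_assoc_inv [simp]: "tensor_assoc (tensor_assoc_inv x) = x"
proof (induction x rule: tensor_induct)
  case (pure a x)
  show ?case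
    by (induction x rule: tensor_induct)
      (simp_all add: tensor_assoc tensor_add_right clinearD[OF tensor_assoc(1)] clinearD[OF tensor_assoc(3)])
qed (simp add: clinearD[OF tensor_assoc(1)] clinearD[OF tensor_assoc(3)])

lemma tensor_assoc_inv_assoc [simp]: "tensor_assoc_inv (tensor_assoc x) = x"
proof (induction x rule: tensor_induct)
  case (pure x c)
  show ?case
    by (induction x rule: tensor_induct)
      (simp_all add: tensor_assoc tensor_add_left clinearD[OF tensor_assoc(1)] clinearD[OF tensor_assoc(3)])
qed (simp add: clinearD[OF tensor_assoc(1)] clinearD[OF tensor_assoc(3)])

lemma tensor_assoc_mult: "tensor_assoc (x * y) = tensor_assoc x * tensor_assoc y"
proof (induction x rule: tensor_induct)
  case (pure x c)
  show ?case
  proof (induction x rule: tensor_induct)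
    case (pure a b)
    show ?case
    proof (induction y rule: tensor_induct)
      case (pure y f)
      show ?case
        by (induction y rule: tensor_induct)
          (simp_all add: tensor_assoc tensor_mult_simps tensor_add_left clinearD[OF tensor_assoc(1)])
    qed (simp add: tensor_mult_simps clinearD[OF tensor_assoc(1)])
  qed (simp add: tensor_mult_simps tensor_add_left clinearD[OF tensor_assoc(1)])
qed (simp add: tensor_mult_simps clinearD[OF tensor_assoc(1)])

lemma tensor_assoc_inv_mult: "tensor_assoc_inv (x * y) = tensor_assoc_inv x * tensor_assoc_inv y"
  by (metis tensor_assoc_mult tensor_assoc_assoc_inv tensor_assoc_inv_assoc)


section \<open>The multiplier algebra\<close>

text \<open>
  A multiplier of \<open>A\<close> is a pair \<open>(L, R)\<close> with \<open>L a = m a\<close>, \<open>R a = a m\<close> (a double centraliser).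
  For a non-degenerate product, linearity and the module properties follow from
  \<open>a (m b) = (a m) b\<close>.
\<close>

definition double_centralizers :: "(('a::calgebra \<Rightarrow> 'a) \<times> ('a \<Rightarrow> 'a)) set" where
  "double_centralizers = {(L, R). clinear L \<and> clinear R \<and> (\<forall>a b. L (a * b) = L a * b) \<and>
     (\<forall>a b. R (a * b) = a * R b) \<and> (\<forall>a b. a * L b = R a * b)}"

typedef (overloaded) ('a::calgebra) multiplier = "double_centralizers :: (('a \<Rightarrow> 'a) \<times> ('a \<Rightarrow> 'a)) set"
  by (rule exI[of _ "(\<lambda>x. x, \<lambda>x. x)"]) (simp add: double_centralizers_def clinear_id)

setup_lifting type_definition_multiplier

lift_definition mult_left :: "'a::calgebra multiplier \<Rightarrow> 'a \<Rightarrow> 'a"  (infixr \<open>\<rhd>\<close> 72) is fst .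

lift_definition mult_right :: "'a::calgebra \<Rightarrow> 'a multiplier \<Rightarrow> 'a"  (infixl \<open>\<lhd>\<close> 72)
  is "\<lambda>a m. snd m a" .

lemma multiplier_eqI:
  assumes "\<And>a. m \<rhd> a = n \<rhd> a" "\<And>a. a \<lhd> m = a \<lhd> n"
  shows "m = n"
  using assms by transfer (auto simp: prod_eq_iff fun_eq_iff)

lemma clinear_mult_left': "clinear (\<lambda>a. m \<rhd> a)" and clinear_mult_right': "clinear (\<lambda>a. a \<lhd> m)"
  by (transfer, auto simp: double_centralizers_def)+

lemma multiplier_module:
  "m \<rhd> (a * b) = (m \<rhd> a) * b" "(a * b) \<lhd> m = a * (b \<lhd> m)" "a * (m \<rhd> b) = (a \<lhd> m) * b"
  by (transfer, auto simp: double_centralizers_def)+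

instantiation multiplier :: (calgebra) "{calgebra, monoid_mult}"
begin

lift_definition zero_multiplier :: "'a multiplier" is "(\<lambda>_. 0, \<lambda>_. 0)"
  by (simp add: double_centralizers_def clinear_iff)

lift_definition one_multiplier :: "'a multiplier" is "(\<lambda>a. a, \<lambda>a. a)"
  by (simp add: double_centralizers_def clinear_iff)

lift_definition plus_multiplier :: "'a multiplier \<Rightarrow> 'a multiplier \<Rightarrow> 'a multiplier"
  is "\<lambda>m n. (\<lambda>a. fst m a + fst n a, \<lambda>a. snd m a + snd n a)"
  by (auto simp: double_centralizers_def clinear_iff algebra_simps scaleC_add_right)

lift_definition uminus_multiplier :: "'a multiplier \<Rightarrow> 'a multiplier"
  is "\<lambda>m. (\<lambda>a. - fst m a, \<lambda>a. - snd m a)"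
  by (auto simp: double_centralizers_def clinear_iff)

lift_definition minus_multiplier :: "'a multiplier \<Rightarrow> 'a multiplier \<Rightarrow> 'a multiplier"
  is "\<lambda>m n. (\<lambda>a. fst m a - fst n a, \<lambda>a. snd m a - snd n a)"
  by (auto simp: double_centralizers_def clinear_iff algebra_simps cvec.scale_right_diff_distrib)

lift_definition scaleC_multiplier :: "complex \<Rightarrow> 'a multiplier \<Rightarrow> 'a multiplier"
  is "\<lambda>c m. (\<lambda>a. c *\<^sub>C fst m a, \<lambda>a. c *\<^sub>C snd m a)"
  by (auto simp: double_centralizers_def clinear_iff scaleC_add_right mult.commute)

lift_definition times_multiplier :: "'a multiplier \<Rightarrow> 'a multiplier \<Rightarrow> 'a multiplier"
  is "\<lambda>m n. (\<lambda>a. fst m (fst n a), \<lambda>a. snd n (snd m a))"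
  by (auto simp: double_centralizers_def clinear_iff)

lemma mult_left_simps [simp]:
  "0 \<rhd> a = 0" "1 \<rhd> a = a" "(m + n) \<rhd> a = m \<rhd> a + n \<rhd> a" "(m - n) \<rhd> a = m \<rhd> a - n \<rhd> a"
  "(- m) \<rhd> a = - (m \<rhd> a)" "(c *\<^sub>C m) \<rhd> a = c *\<^sub>C (m \<rhd> a)" "(m * n) \<rhd> a = m \<rhd> n \<rhd> a"
  for m n :: "'a multiplier"
  by (simp_all add: mult_left.rep_eq mult_right.rep_eq zero_multiplier.rep_eq one_multiplier.rep_eq
      plus_multiplier.rep_eq minus_multiplier.rep_eq uminus_multiplier.rep_eq scaleC_multiplier.rep_eq
      times_multiplier.rep_eq)

lemma mult_right_simps [simp]:
  "a \<lhd> 0 = 0" "a \<lhd> 1 = a" "a \<lhd> (m + n) = a \<lhd> m + a \<lhd> n" "a \<lhd> (m - n) = a \<lhd> m - a \<lhd> n"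
  "a \<lhd> (- m) = - (a \<lhd> m)" "a \<lhd> (c *\<^sub>C m) = c *\<^sub>C (a \<lhd> m)" "a \<lhd> (m * n) = a \<lhd> m \<lhd> n"
  for m n :: "'a multiplier"
  by (simp_all add: mult_left.rep_eq mult_right.rep_eq zero_multiplier.rep_eq one_multiplier.rep_eq
      plus_multiplier.rep_eq minus_multiplier.rep_eq uminus_multiplier.rep_eq scaleC_multiplier.rep_eq
      times_multiplier.rep_eq)

instance
  by standard
    (rule multiplier_eqI;
      simp add: scaleC_add_right scaleC_add_left clinearD[OF clinear_mult_left'] clinearD[OF clinear_mult_right'])+

end

lift_definition mult_of :: "'a::calgebra \<Rightarrow> 'a multiplier" is "\<lambda>a. (\<lambda>b. a * b, \<lambda>b. b * a)"
  by (simp add: double_centralizers_def clinear_iff algebra_simps)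

lemma mult_of_simps [simp]: "mult_of a \<rhd> b = a * b" "b \<lhd> mult_of a = b * a"
  by (transfer, simp)+

text \<open>Inverse of the embedding \<open>A \<subseteq> M(A)\<close>; meaningful on \<^term>\<open>range mult_of\<close> only.\<close>

definition as_element :: "'a::calgebra multiplier \<Rightarrow> 'a"
  where "as_element = inv mult_of"

lemma double_centralizers_tensor_map:
  assumes "(L, R) \<in> double_centralizers" "(L', R') \<in> double_centralizers"
  shows "(tensor_map L L', tensor_map R R') \<in> double_centralizers"
proof -
  have lin: "clinear L" "clinear R" "clinear L'" "clinear R'"
    using assms by (auto simp: double_centralizers_def)
  have eqs: "L (a * b) = L a * b" "R (a * b) = a * R b" "a * L b = R a * b"
    "L' (c * d) = L' c * d" "R' (c * d) = c * R' d" "c * L' d = R' c * d" for a b c d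
    using assms by (auto simp: double_centralizers_def)
  note simps = tensor_map lin eqs clinearD[OF tensor_map(1)] tensor_mult_simps
  have "tensor_map L L' (x * y) = tensor_map L L' x * y
      \<and> tensor_map R R' (x * y) = x * tensor_map R R' y
      \<and> x * tensor_map L L' y = tensor_map R R' x * y" for x y
  proof (induction x rule: tensor_induct)
    case (pure a b)
    show ?case by (induction y rule: tensor_induct) (simp_all add: simps)
  qed (simp add: simps)
  then show ?thesis by (simp add: double_centralizers_def tensor_map lin)
qed

lift_definition mult_tensor ::
  "'a::calgebra multiplier \<Rightarrow> 'b::calgebra multiplier \<Rightarrow> ('a \<otimes> 'b) multiplier"  (infixr \<open>\<boxtimes>\<close> 71)
  is "\<lambda>m n. (tensor_map (fst m) (fst n), tensor_map (snd m) (snd n))"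
  by (simp add: double_centralizers_tensor_map)

lemma mult_tensor_pure [simp]:
  "(m \<boxtimes> n) \<rhd> (a \<otimes> b) = (m \<rhd> a) \<otimes> (n \<rhd> b)" "(a \<otimes> b) \<lhd> (m \<boxtimes> n) = (a \<lhd> m) \<otimes> (b \<lhd> n)"
  by (simp_all add: mult_left.rep_eq mult_right.rep_eq mult_tensor.rep_eq
      tensor_map clinear_mult_left'[unfolded mult_left.rep_eq]
      clinear_mult_right'[unfolded mult_right.rep_eq])

lemma multiplier_tensor_eqI:
  fixes m n :: "('a::calgebra \<otimes> 'b::calgebra) multiplier"
  assumes "\<And>a b. m \<rhd> (a \<otimes> b) = n \<rhd> (a \<otimes> b)" "\<And>a b. (a \<otimes> b) \<lhd> m = (a \<otimes> b) \<lhd> n"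
  shows "m = n"
proof (rule multiplier_eqI)
  fix x
  show "m \<rhd> x = n \<rhd> x"
    by (rule tensor_ext[where f = "\<lambda>x. m \<rhd> x"]) (simp_all only: assms clinear_mult_left')
  show "x \<lhd> m = x \<lhd> n"
    by (rule tensor_ext[where f = "\<lambda>x. x \<lhd> m"]) (simp_all only: assms clinear_mult_right')
qed

lemma mult_of_pure_tensor: "mult_of (a \<otimes> b) = mult_of a \<boxtimes> mult_of b"
  by (rule multiplier_tensor_eqI) (simp_all add: times_pure_tensor)

lemma one_mult_tensor: "1 \<boxtimes> 1 = 1"
  by (rule multiplier_tensor_eqI) simp_all

lemma mult_tensor_times: "(m \<boxtimes> n) * (m' \<boxtimes> n') = (m * m') \<boxtimes> (n * n')"
  by (rule multiplier_tensor_eqI) simp_all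

lemma double_centralizers_conjugate:
  assumes "(L, R) \<in> double_centralizers" "clinear f" "clinear g"
    "\<And>x. f (g x) = x" "\<And>x y. f (x * y) = f x * f y" "\<And>x y. g (x * y) = g x * g y"
  shows "(\<lambda>x. f (L (g x)), \<lambda>x. f (R (g x))) \<in> double_centralizers"
proof -
  have "a * f (L (g b)) = f (R (g a)) * b" for a b
    using assms(1) assms(5)[of "g a" "L (g b)"] assms(5)[of "R (g a)" "g b"]
    by (auto simp: double_centralizers_def assms(4))
  moreover have "f (L (g (a * b))) = f (L (g a)) * b" "f (R (g (a * b))) = a * f (R (g b))" for a b
    using assms(1) by (auto simp: double_centralizers_def assms(4-6))
  ultimately show ?thesis
    using assms(1-3) by (simp add: double_centralizers_def clinear_iff)
qed

lift_definition mult_assoc ::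
  "(('a::calgebra \<otimes> 'b::calgebra) \<otimes> 'c::calgebra) multiplier \<Rightarrow> ('a \<otimes> 'b \<otimes> 'c) multiplier"
  is "\<lambda>m. (\<lambda>x. tensor_assoc (fst m (tensor_assoc_inv x)), \<lambda>x. tensor_assoc (snd m (tensor_assoc_inv x)))"
  by (rule double_centralizers_conjugate)
    (simp_all add: tensor_assoc tensor_assoc_mult tensor_assoc_inv_mult)

lift_definition mult_swap23 ::
  "('a::calgebra \<otimes> 'b::calgebra \<otimes> 'c::calgebra) multiplier \<Rightarrow> ('a \<otimes> 'c \<otimes> 'b) multiplier"
  is "\<lambda>m. (\<lambda>x. tensor_map (\<lambda>a. a) tensor_swap (fst m (tensor_map (\<lambda>a. a) tensor_swap x)),
           \<lambda>x. tensor_map (\<lambda>a. a) tensor_swap (snd m (tensor_map (\<lambda>a. a) tensor_swap x)))"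
  by (rule double_centralizers_conjugate)
    (simp_all add: tensor_map tensor_map_comp tensor_map_id tensor_map_mult clinear_id
      tensor_swap tensor_swap_mult)

text \<open>Leg numbering: \<open>X \<otimes> 1\<close> and \<open>X\<^sub>1\<^sub>3\<close> for \<open>X \<in> M(A \<otimes> A)\<close>; \<open>1 \<otimes> X\<close> is \<^term>\<open>1 \<boxtimes> X\<close>.\<close>

definition leg12 :: "('a::calgebra \<otimes> 'a) multiplier \<Rightarrow> ('a \<otimes> 'a \<otimes> 'a) multiplier"
  where "leg12 X = mult_assoc (X \<boxtimes> 1)"

definition leg13 :: "('a::calgebra \<otimes> 'a) multiplier \<Rightarrow> ('a \<otimes> 'a \<otimes> 'a) multiplier"
  where "leg13 X = mult_swap23 (leg12 X)"

lemma multiplier_tensor3_eqI: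
  fixes m n :: "('a::calgebra \<otimes> 'b::calgebra \<otimes> 'c::calgebra) multiplier"
  assumes "\<And>a b c. m \<rhd> (a \<otimes> b \<otimes> c) = n \<rhd> (a \<otimes> b \<otimes> c)" "\<And>a b c. (a \<otimes> b \<otimes> c) \<lhd> m = (a \<otimes> b \<otimes> c) \<lhd> n"
  shows "m = n"
proof (rule multiplier_tensor_eqI)
  fix a :: 'a and x :: "'b \<otimes> 'c"
  show "m \<rhd> (a \<otimes> x) = n \<rhd> (a \<otimes> x)" "(a \<otimes> x) \<lhd> m = (a \<otimes> x) \<lhd> n"
    by (induction x rule: tensor_induct)
      (simp_all add: assms tensor_add_right clinearD[OF clinear_mult_left'] clinearD[OF clinear_mult_right'])
qed

lemma mult_assoc_apply:
  "mult_assoc M \<rhd> x = tensor_assoc (M \<rhd> tensor_assoc_inv x)"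
  "x \<lhd> mult_assoc M = tensor_assoc (tensor_assoc_inv x \<lhd> M)"
  by (transfer, simp)+

lemma mult_swap23_apply:
  "mult_swap23 M \<rhd> x = tensor_map (\<lambda>a. a) tensor_swap (M \<rhd> tensor_map (\<lambda>a. a) tensor_swap x)"
  "x \<lhd> mult_swap23 M = tensor_map (\<lambda>a. a) tensor_swap (tensor_map (\<lambda>a. a) tensor_swap x \<lhd> M)"
  by (transfer, simp)+

lemma leg12_mult_tensor: "leg12 (m \<boxtimes> n) = m \<boxtimes> n \<boxtimes> 1"
  by (rule multiplier_tensor3_eqI) (simp_all add: leg12_def mult_assoc_apply tensor_assoc)

lemma leg13_mult_tensor: "leg13 (m \<boxtimes> n) = m \<boxtimes> 1 \<boxtimes> n"
  by (rule multiplier_tensor3_eqI)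
    (simp_all add: leg13_def leg12_mult_tensor mult_swap23_apply tensor_map clinear_id tensor_swap)


section \<open>Coproducts and counits\<close>

definition nondegenerate_algebra :: "'a::calgebra itself \<Rightarrow> bool" where
  "nondegenerate_algebra _ \<longleftrightarrow>
     (\<forall>a::'a. (\<forall>b. a * b = 0) \<longrightarrow> a = 0) \<and> (\<forall>a::'a. (\<forall>b. b * a = 0) \<longrightarrow> a = 0)"

definition idempotent_algebra :: "'a::calgebra itself \<Rightarrow> bool" where
  "idempotent_algebra _ \<longleftrightarrow> cvec.span {a * b |a b. True} = (UNIV :: 'a set)"

text \<open>\<open>T\<^sub>1(a \<otimes> b) = \<Delta>(a)(1 \<otimes> b)\<close> and \<open>T\<^sub>2(a \<otimes> b) = (a \<otimes> 1)\<Delta>(b)\<close>, as elements of \<open>A \<otimes> A\<close>.\<close>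

definition T1 :: "('a::calgebra \<Rightarrow> ('a \<otimes> 'a) multiplier) \<Rightarrow> 'a \<otimes> 'a \<Rightarrow> 'a \<otimes> 'a"
  where "T1 \<Delta> = tensor_lift (\<lambda>a b. as_element (\<Delta> a * (1 \<boxtimes> mult_of b)))"

definition T2 :: "('a::calgebra \<Rightarrow> ('a \<otimes> 'a) multiplier) \<Rightarrow> 'a \<otimes> 'a \<Rightarrow> 'a \<otimes> 'a"
  where "T2 \<Delta> = tensor_lift (\<lambda>a b. as_element ((mult_of a \<boxtimes> 1) * \<Delta> b))"

definition Delta_id ::
  "('a::calgebra \<Rightarrow> ('a \<otimes> 'a) multiplier) \<Rightarrow> 'a \<otimes> 'a \<Rightarrow> ('a \<otimes> 'a \<otimes> 'a) multiplier"
  where "Delta_id \<Delta> = tensor_lift (\<lambda>p q. leg12 (\<Delta> p) * (1 \<boxtimes> 1 \<boxtimes> mult_of q))"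

definition id_Delta ::
  "('a::calgebra \<Rightarrow> ('a \<otimes> 'a) multiplier) \<Rightarrow> 'a \<otimes> 'a \<Rightarrow> ('a \<otimes> 'a \<otimes> 'a) multiplier"
  where "id_Delta \<Delta> = tensor_lift (\<lambda>p q. mult_of p \<boxtimes> \<Delta> q)"

locale coproduct =
  fixes \<Delta> :: "'a::calgebra \<Rightarrow> ('a \<otimes> 'a) multiplier"
  assumes Delta_linear: "clinear \<Delta>"
    and Delta_mult: "\<Delta> (a * b) = \<Delta> a * \<Delta> b"
    and Delta_right: "\<Delta> a * (1 \<boxtimes> mult_of b) \<in> range mult_of"
    and Delta_left: "(mult_of a \<boxtimes> 1) * \<Delta> b \<in> range mult_of"
    and coassociative:
      "(mult_of a \<boxtimes> 1 \<boxtimes> 1) * Delta_id \<Delta> (T1 \<Delta> (b \<otimes> c)) =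
       id_Delta \<Delta> (T2 \<Delta> (a \<otimes> b)) * (1 \<boxtimes> 1 \<boxtimes> mult_of c)"

definition tensor_subspace :: "'a::cvector_space set \<Rightarrow> 'b::cvector_space set \<Rightarrow> ('a \<otimes> 'b) set"
  where "tensor_subspace V W = cvec.span {v \<otimes> w |v w. v \<in> V \<and> w \<in> W}"

definition left_leg :: "('a::calgebra \<Rightarrow> ('a \<otimes> 'a) multiplier) \<Rightarrow> 'a set" where
  "left_leg \<Delta> = \<Inter>{V. cvec.subspace V \<and> (\<forall>a b. T1 \<Delta> (a \<otimes> b) \<in> tensor_subspace V UNIV)}"

definition right_leg :: "('a::calgebra \<Rightarrow> ('a \<otimes> 'a) multiplier) \<Rightarrow> 'a set" where
  "right_leg \<Delta> = \<Inter>{W. cvec.subspace W \<and> (\<forall>a b. T2 \<Delta> (a \<otimes> b) \<in> tensor_subspace UNIV W)}"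

definition full_coproduct :: "('a::calgebra \<Rightarrow> ('a \<otimes> 'a) multiplier) \<Rightarrow> bool"
  where "full_coproduct \<Delta> \<longleftrightarrow> coproduct \<Delta> \<and> left_leg \<Delta> = UNIV \<and> right_leg \<Delta> = UNIV"

text \<open>The slice maps \<open>f \<otimes> id\<close> and \<open>id \<otimes> f\<close> on \<open>A \<otimes> A\<close>, for a linear functional \<open>f\<close>.\<close>

definition slice1 :: "('a::cvector_space \<Rightarrow> complex) \<Rightarrow> 'a \<otimes> 'a \<Rightarrow> 'a"
  where "slice1 f = tensor_lift (\<lambda>a b. f a *\<^sub>C b)"

definition slice2 :: "('a::cvector_space \<Rightarrow> complex) \<Rightarrow> 'a \<otimes> 'a \<Rightarrow> 'a"
  where "slice2 f = tensor_lift (\<lambda>a b. f b *\<^sub>C a)"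

definition counit :: "('a::calgebra \<Rightarrow> ('a \<otimes> 'a) multiplier) \<Rightarrow> ('a \<Rightarrow> complex) \<Rightarrow> bool" where
  "counit \<Delta> \<epsilon> \<longleftrightarrow> clinear \<epsilon> \<and>
     (\<forall>a b. slice1 \<epsilon> (T1 \<Delta> (a \<otimes> b)) = a * b) \<and> (\<forall>a c. slice2 \<epsilon> (T2 \<Delta> (c \<otimes> a)) = c * a)"


section \<open>Weak multiplier Hopf algebras\<close>

text \<open>
  \<open>\<Phi>\<close> is the extension to \<open>M(B)\<close> of a homomorphism \<open>\<phi> : B \<rightarrow> M(C)\<close>, with \<open>\<Phi>(1)\<close> equal to the
  idempotent \<open>P\<close>. It exists and is unique when \<open>\<phi>(B) C = P C\<close> and \<open>C \<phi>(B) = C P\<close>.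
\<close>

definition multiplier_extension ::
  "('b::calgebra \<Rightarrow> 'c::calgebra multiplier) \<Rightarrow> 'c multiplier \<Rightarrow> ('b multiplier \<Rightarrow> 'c multiplier) \<Rightarrow> bool"
  where "multiplier_extension \<phi> P \<Phi> \<longleftrightarrow>
     clinear \<Phi> \<and> (\<forall>m n. \<Phi> (m * n) = \<Phi> m * \<Phi> n) \<and> (\<forall>b. \<Phi> (mult_of b) = \<phi> b) \<and> \<Phi> 1 = P"

text \<open>
  The counit \<open>\<epsilon>\<close>, the idempotent \<open>E\<close> and the maps \<open>G\<^sub>1\<close>, \<open>G\<^sub>2\<close> are uniquely determined by \<open>\<Delta>\<close>;
  they are parameters so that they can be named. Triple tensor products are nested to the right,
  so \<open>G\<^sub>1 \<otimes> id\<close> is conjugated by the associativity isomorphism.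
\<close>

locale weak_multiplier_Hopf_algebra =
  fixes \<Delta> :: "'a::calgebra \<Rightarrow> ('a \<otimes> 'a) multiplier"
    and \<epsilon> :: "'a \<Rightarrow> complex"
    and E :: "('a \<otimes> 'a) multiplier"
    and G1 G2 :: "'a \<otimes> 'a \<Rightarrow> 'a \<otimes> 'a"
  assumes nondegenerate: "nondegenerate_algebra TYPE('a)"
    and idempotent: "idempotent_algebra TYPE('a)"
    and full: "full_coproduct \<Delta>"
    and counit: "counit \<Delta> \<epsilon>"
    and E_idem: "E * E = E"
    and range_T1: "range (T1 \<Delta>) = range (\<lambda>x. E \<rhd> x)"
    and range_T2: "range (T2 \<Delta>) = range (\<lambda>x. x \<lhd> E)"
    and id_Delta_E: "\<exists>\<Phi>. multiplier_extension (id_Delta \<Delta>) (1 \<boxtimes> E) \<Phi> \<and>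
      \<Phi> E = leg12 E * (1 \<boxtimes> E) \<and> \<Phi> E = (1 \<boxtimes> E) * leg12 E"
    and G1_linear: "clinear G1"
    and G2_linear: "clinear G2"
    and G1: "mult_of (tensor_assoc (tensor_map G1 (\<lambda>x. x) (tensor_assoc_inv
        (as_element (leg13 (\<Delta> a) * (1 \<boxtimes> mult_of b \<boxtimes> mult_of c)))))) =
      leg13 (\<Delta> a) * (1 \<boxtimes> E) * (1 \<boxtimes> mult_of b \<boxtimes> mult_of c)"
    and G2: "mult_of (tensor_map (\<lambda>x. x) G2
        (as_element ((mult_of a \<boxtimes> mult_of b \<boxtimes> 1) * leg13 (\<Delta> c)))) =
      (mult_of a \<boxtimes> mult_of b \<boxtimes> 1) * leg12 E * leg13 (\<Delta> c)"
    and kernel_T1: "{x. T1 \<Delta> x = 0} = range (\<lambda>x. x - G1 x)"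
    and kernel_T2: "{x. T2 \<Delta> x = 0} = range (\<lambda>x. x - G2 x)"

text \<open>
  For \<open>\<epsilon>\<^sub>t(a) = \<Sum> a\<^sub>(\<^sub>1\<^sub>) S(a\<^sub>(\<^sub>2\<^sub>))\<close> and \<open>\<epsilon>\<^sub>s(a) = \<Sum> S(a\<^sub>(\<^sub>1\<^sub>)) a\<^sub>(\<^sub>2\<^sub>)\<close>, the products
  \<open>c \<epsilon>\<^sub>t(a) = \<Sum> c a\<^sub>(\<^sub>1\<^sub>) S(a\<^sub>(\<^sub>2\<^sub>))\<close> and \<open>\<epsilon>\<^sub>s(a) c = \<Sum> S(a\<^sub>(\<^sub>1\<^sub>)) a\<^sub>(\<^sub>2\<^sub>) c\<close> are covered by
  \<open>(c \<otimes> 1)\<Delta>(a)\<close> and \<open>\<Delta>(a)(1 \<otimes> c)\<close>.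
\<close>

definition mult_eps_t ::
  "('a::calgebra \<Rightarrow> ('a \<otimes> 'a) multiplier) \<Rightarrow> ('a \<Rightarrow> 'a multiplier) \<Rightarrow> 'a \<Rightarrow> 'a \<Rightarrow> 'a"
  where "mult_eps_t \<Delta> S c a = tensor_lift (\<lambda>p q. p \<lhd> S q) (T2 \<Delta> (c \<otimes> a))"

definition eps_s_mult ::
  "('a::calgebra \<Rightarrow> ('a \<otimes> 'a) multiplier) \<Rightarrow> ('a \<Rightarrow> 'a multiplier) \<Rightarrow> 'a \<Rightarrow> 'a \<Rightarrow> 'a"
  where "eps_s_mult \<Delta> S a c = tensor_lift (\<lambda>p q. S p \<rhd> q) (T1 \<Delta> (a \<otimes> c))"

definition eps_t ::
  "('a::calgebra \<Rightarrow> ('a \<otimes> 'a) multiplier) \<Rightarrow> ('a \<Rightarrow> 'a multiplier) \<Rightarrow> 'a \<Rightarrow> 'a multiplier"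
  where "eps_t \<Delta> S a = (THE m. \<forall>c. c \<lhd> m = mult_eps_t \<Delta> S c a)"

text \<open>
  The Sweedler formulas are multiplied by elements of \<open>A\<close> in the legs where they are not covered:
  \<^item> \<open>(c \<otimes> d) E (a \<otimes> b) = \<Sum> c a\<^sub>(\<^sub>1\<^sub>) \<otimes> d a\<^sub>(\<^sub>2\<^sub>) S(a\<^sub>(\<^sub>3\<^sub>)) b\<close>
  \<^item> \<open>(a \<otimes> b) E (c \<otimes> d) = \<Sum> a S(b\<^sub>(\<^sub>1\<^sub>)) b\<^sub>(\<^sub>2\<^sub>) c \<otimes> b\<^sub>(\<^sub>3\<^sub>) d\<close>
  \<^item> \<open>(c \<otimes> 1) G\<^sub>1(a \<otimes> b) = \<Sum> c a\<^sub>(\<^sub>1\<^sub>) \<otimes> S(a\<^sub>(\<^sub>2\<^sub>)) a\<^sub>(\<^sub>3\<^sub>) b\<close>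
  \<^item> \<open>G\<^sub>2(a \<otimes> b) (1 \<otimes> c) = \<Sum> a b\<^sub>(\<^sub>1\<^sub>) S(b\<^sub>(\<^sub>2\<^sub>)) \<otimes> b\<^sub>(\<^sub>3\<^sub>) c\<close>

  In \<open>\<Sum> S(a\<^sub>(\<^sub>1\<^sub>)) a\<^sub>(\<^sub>2\<^sub>) S(a\<^sub>(\<^sub>3\<^sub>)) = S(a)\<close>, an equality of multipliers, the covering after multiplication
  by \<open>b\<close> on the right is \<open>\<Sum> a\<^sub>(\<^sub>1\<^sub>) \<otimes> a\<^sub>(\<^sub>2\<^sub>) S(a\<^sub>(\<^sub>3\<^sub>)) b = E (a \<otimes> b)\<close>, and after multiplication by \<open>c\<close> on the
  left it is \<open>\<Sum> c S(a\<^sub>(\<^sub>1\<^sub>)) a\<^sub>(\<^sub>2\<^sub>) \<otimes> a\<^sub>(\<^sub>3\<^sub>) = (c \<otimes> a) E\<close>.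
\<close>

locale antipode = weak_multiplier_Hopf_algebra \<Delta> \<epsilon> E G1 G2
  for \<Delta> :: "'a::calgebra \<Rightarrow> ('a \<otimes> 'a) multiplier" and \<epsilon> E G1 G2 +
  fixes S :: "'a \<Rightarrow> 'a multiplier"
  assumes S_linear: "clinear S"
    and S_antimult: "S (a * b) = S b * S a"
    and S_nondegenerate: "cvec.span {S a \<rhd> b |a b. True} = UNIV" "cvec.span {b \<lhd> S a |a b. True} = UNIV"
    and S_E_left: "(c \<otimes> d) * (E \<rhd> (a \<otimes> b)) =
      tensor_lift (\<lambda>p q. p \<otimes> (mult_eps_t \<Delta> S d q * b)) (T2 \<Delta> (c \<otimes> a))"
    and S_E_right: "((a \<otimes> b) \<lhd> E) * (c \<otimes> d) =
      tensor_lift (\<lambda>p q. (a * eps_s_mult \<Delta> S p c) \<otimes> q) (T1 \<Delta> (b \<otimes> d))"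
    and S_G1: "(mult_of c \<boxtimes> 1) \<rhd> G1 (a \<otimes> b) =
      tensor_lift (\<lambda>p q. p \<otimes> eps_s_mult \<Delta> S q b) (T2 \<Delta> (c \<otimes> a))"
    and S_G2: "G2 (a \<otimes> b) \<lhd> (1 \<boxtimes> mult_of c) =
      tensor_lift (\<lambda>p q. mult_eps_t \<Delta> S a p \<otimes> q) (T1 \<Delta> (b \<otimes> c))"
    and S_id_S_left: "tensor_lift (\<lambda>p q. S p \<rhd> q) (E \<rhd> (a \<otimes> b)) = S a \<rhd> b"
    and S_id_S_right: "tensor_lift (\<lambda>p q. p \<lhd> S q) ((c \<otimes> a) \<lhd> E) = c \<lhd> S a"

locale regular_weak_multiplier_Hopf_algebra = antipode +
  assumes regular: "bij_betw S UNIV (range mult_of)"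


section \<open>Cointegrals and quasi-Frobenius algebras\<close>

definition left_cointegral ::
  "('a::calgebra \<Rightarrow> ('a \<otimes> 'a) multiplier) \<Rightarrow> ('a \<Rightarrow> 'a multiplier) \<Rightarrow> 'a multiplier \<Rightarrow> bool"
  where "left_cointegral \<Delta> S h \<longleftrightarrow> h \<noteq> 0 \<and> (\<forall>a. mult_of a * h = eps_t \<Delta> S a * h)"

text \<open>
  \<open>(id \<otimes> f)X\<close> and \<open>(f \<otimes> id)X\<close> in \<open>M(A)\<close>. They are used for \<open>X = \<Delta>(a)\<close> in the regular case, where
  all the products below lie in \<open>A \<otimes> A\<close>.
\<close>

definition id_slice :: "('a::calgebra \<Rightarrow> complex) \<Rightarrow> ('a \<otimes> 'a) multiplier \<Rightarrow> 'a multiplier" where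
  "id_slice f X = (THE m. \<forall>b.
     m \<rhd> b = slice2 f (as_element (X * (mult_of b \<boxtimes> 1))) \<and>
     b \<lhd> m = slice2 f (as_element ((mult_of b \<boxtimes> 1) * X)))"

definition slice_id :: "('a::calgebra \<Rightarrow> complex) \<Rightarrow> ('a \<otimes> 'a) multiplier \<Rightarrow> 'a multiplier" where
  "slice_id f X = (THE m. \<forall>b.
     m \<rhd> b = slice1 f (as_element (X * (1 \<boxtimes> mult_of b))) \<and>
     b \<lhd> m = slice1 f (as_element ((1 \<boxtimes> mult_of b) * X)))"

definition faithful_left_cointegral ::
  "('a::calgebra \<Rightarrow> ('a \<otimes> 'a) multiplier) \<Rightarrow> ('a \<Rightarrow> 'a multiplier) \<Rightarrow> 'a \<Rightarrow> bool"
  where "faithful_left_cointegral \<Delta> S h \<longleftrightarrow> left_cointegral \<Delta> S (mult_of h) \<and>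
     (\<forall>f. clinear f \<longrightarrow> id_slice f (\<Delta> h) = 0 \<or> slice_id f (\<Delta> h) = 0 \<longrightarrow> (\<forall>a. f a = 0))"

definition right_annihilator :: "'a::calgebra set \<Rightarrow> 'a set"
  where "right_annihilator I = {a. \<forall>x\<in>I. x * a = 0}"

definition left_annihilator :: "'a::calgebra set \<Rightarrow> 'a set"
  where "left_annihilator I = {a. \<forall>x\<in>I. a * x = 0}"

text \<open>Ideals of an algebra are linear subspaces (not automatic without a unit).\<close>

definition left_ideal :: "'a::calgebra set \<Rightarrow> bool"
  where "left_ideal I \<longleftrightarrow> cvec.subspace I \<and> (\<forall>a. \<forall>x\<in>I. a * x \<in> I)"

definition right_ideal :: "'a::calgebra set \<Rightarrow> bool"
  where "right_ideal J \<longleftrightarrow> cvec.subspace J \<and> (\<forall>a. \<forall>x\<in>J. x * a \<in> J)"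

definition quasi_Frobenius :: "'a::calgebra itself \<Rightarrow> bool" where
  "quasi_Frobenius _ \<longleftrightarrow>
     (\<forall>I :: 'a set. left_ideal I \<longrightarrow> left_annihilator (right_annihilator I) = I) \<and>
     (\<forall>J :: 'a set. right_ideal J \<longrightarrow> right_annihilator (left_annihilator J) = J)"

end

theory Submission
  imports Defs
begin

text \<open>
  A left cointegral satisfies \<open>(1 \<otimes> a)\<Delta>(h) = (S(a) \<otimes> 1)\<Delta>(h)\<close>. Put \<open>b\<^sub>g = (g \<otimes> id)\<Delta>(h)\<close> for \<open>g \<in> A'\<close>;
  then \<open>a b\<^sub>g = b\<^sub>g\<^sub>'\<close> with \<open>g' = g(S(a)\<cdot>)\<close>, and \<open>g \<mapsto> b\<^sub>g\<close> is injective by faithfulness. If \<open>I\<close> is a left ideal and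
  \<open>f\<close> vanishes on \<open>I\<close>, then \<open>g = f \<circ> S\<^sup>-\<^sup>1\<close> gives \<open>b\<^sub>g A \<subseteq> r(I)\<close>; so \<open>x \<in> l(r(I))\<close> implies \<open>x b\<^sub>g = 0\<close>, that is,
  \<open>f(A x) = 0\<close>. Hence \<open>A x \<subseteq> I\<close>, and it remains to see that \<open>x \<in> A x\<close>.

  The same relation shows that the left legs of each \<open>\<Delta>(h)(1 \<otimes> b)\<close> span a finite-dimensional left
  ideal. These ideals span \<open>A\<close>, so every \<open>A x\<close> is finite-dimensional. This makes \<open>E(x \<otimes> 1)\<close> a finite
  sum \<open>\<Sum> v\<^sub>i x \<otimes> \<epsilon>\<^sub>t(q\<^sub>i)\<close>, and \<open>\<Sum> S(E\<^sub>1) E\<^sub>2 = 1\<close> yields \<open>S(x) = S(x) \<Sum> S(v\<^sub>i) \<epsilon>\<^sub>t(q\<^sub>i) \<in> S(x) A\<close>. Right ideals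
  are reduced to left ideals by the anti-automorphism \<open>S\<close>.
\<close>

section \<open>Linear functionals and slices\<close>

lemma cbilinearI:
  assumes "\<And>a a' b. \<beta> (a + a') b = \<beta> a b + \<beta> a' b" "\<And>a b b'. \<beta> a (b + b') = \<beta> a b + \<beta> a b'"
    "\<And>c a b. \<beta> (c *\<^sub>C a) b = c *\<^sub>C \<beta> a b" "\<And>c a b. \<beta> a (c *\<^sub>C b) = c *\<^sub>C \<beta> a b"
  shows "cbilinear \<beta>"
  using assms by (simp add: cbilinear_def clinear_iff)

lemma clinear_representation:
  assumes "cvec.independent B" "cvec.span B = UNIV"
  shows "clinear (\<lambda>v. cvec.representation B v b)"
  by (rule clinearI) (simp_all add: cvec.representation_add cvec.representation_scale assms)

text \<open>A basis of \<open>W\<close> together with \<open>x\<close> extends to a basis of the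
  whole space; the coordinate functional at \<open>x\<close> has the required properties.\<close>

lemma functional_separates_subspace:
  fixes x :: "'a::cvector_space"
  assumes W: "cvec.subspace W" and x: "x \<notin> W"
  shows "\<exists>f :: 'a \<Rightarrow> complex. clinear f \<and> (\<forall>w\<in>W. f w = 0) \<and> f x \<noteq> 0"
proof -
  obtain B where B: "B \<subseteq> W" "cvec.independent B" "W \<subseteq> cvec.span B"
    by (rule cvec.maximal_independent_subset)
  have "cvec.span B \<subseteq> W" using B(1) W by (rule cvec.span_minimal)
  then have xB: "x \<notin> cvec.span B" using x by auto
  then have ins: "cvec.independent (insert x B)" using B(2) by (simp add: cvec.independent_insertI)
  define C where "C = cvec.extend_basis (insert x B)"
  have C: "cvec.independent C" "cvec.span C = UNIV" "insert x B \<subseteq> C"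
    using cvec.independent_extend_basis[OF ins] cvec.span_extend_basis[OF ins]
      cvec.extend_basis_superset[OF ins] by (simp_all add: C_def)
  show ?thesis
  proof (intro exI conjI ballI)
    show "clinear (\<lambda>v. cvec.representation C v x)" by (rule clinear_representation) fact+
    show "cvec.representation C w x = 0" if "w \<in> W" for w
    proof -
      have "cvec.representation C w = cvec.representation B w"
        using C B that by (intro cvec.representation_extend) auto
      moreover have "x \<notin> B" using xB by (auto intro: cvec.span_base)
      ultimately show ?thesis using cvec.representation_ne_zero[of B w x] by auto
    qed
    show "cvec.representation C x x \<noteq> 0"
      using C by (simp add: cvec.representation_basis)
  qed
qed

lemma functionals_separate:
  fixes x :: "'a::cvector_space"
  assumes "\<And>f :: 'a \<Rightarrow> complex. clinear f \<Longrightarrow> f x = 0"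
  shows "x = 0"
proof (rule ccontr)
  assume "x \<noteq> 0"
  then have "x \<notin> {0}" by simp
  from functional_separates_subspace[OF cvec.subspace_single_0 this] obtain f :: "'a \<Rightarrow> complex"
    where "clinear f" "f x \<noteq> 0" by blast
  then show False using assms by simp
qed

text \<open>Versions of \<^const>\<open>slice1\<close> and \<^const>\<open>slice2\<close> for two different algebras.\<close>

definition left_slice :: "('a::cvector_space \<Rightarrow> complex) \<Rightarrow> 'a \<otimes> 'b::cvector_space \<Rightarrow> 'b"
  where "left_slice f = tensor_lift (\<lambda>a b. f a *\<^sub>C b)"

definition right_slice :: "('b::cvector_space \<Rightarrow> complex) \<Rightarrow> 'a::cvector_space \<otimes> 'b \<Rightarrow> 'a"
  where "right_slice f = tensor_lift (\<lambda>a b. f b *\<^sub>C a)"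

lemma slice1_eq_left_slice: "slice1 = left_slice"
  by (simp add: fun_eq_iff slice1_def left_slice_def)

lemma left_slice:
  assumes "clinear f"
  shows "clinear (left_slice f)" "left_slice f (a \<otimes> b) = f a *\<^sub>C b"
proof -
  have "cbilinear (\<lambda>a b. f a *\<^sub>C b)"
    by (rule cbilinearI)
      (simp_all add: clinearD[OF assms] scaleC_add_left scaleC_add_right mult.commute)
  from tensor_lift[OF this] show "clinear (left_slice f)" "left_slice f (a \<otimes> b) = f a *\<^sub>C b"
    unfolding left_slice_def by auto
qed

lemma right_slice:
  assumes "clinear f"
  shows "clinear (right_slice f)" "right_slice f (a \<otimes> b) = f b *\<^sub>C a"
proof -
  have "cbilinear (\<lambda>a b. f b *\<^sub>C a)"
    by (rule cbilinearI)
      (simp_all add: clinearD[OF assms] scaleC_add_left scaleC_add_right mult.commute)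
  from tensor_lift[OF this] show "clinear (right_slice f)" "right_slice f (a \<otimes> b) = f b *\<^sub>C a"
    unfolding right_slice_def by auto
qed

text \<open>A Fubini rule: both sides are \<open>f \<otimes> g\<close> evaluated at
  \<open>z\<close>. It transfers statements about one leg to the other.\<close>

lemma left_slice_functional_right_slice:
  assumes "clinear f" "clinear g"
  shows "g (left_slice f z) = f (right_slice g z)"
  by (rule tensor_ext[OF clinear_comp[OF assms(2) left_slice(1)[OF assms(1)]]
        clinear_comp[OF assms(1) right_slice(1)[OF assms(2)]]])
    (simp add: assms left_slice right_slice clinearD(2)[OF assms(1)] clinearD(2)[OF assms(2)] mult.commute)

lemma left_slice_tensor_map:
  assumes "clinear f" "clinear L" "clinear R"
  shows "left_slice f (tensor_map L R z) = R (left_slice (\<lambda>a. f (L a)) z)"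
proof (rule tensor_ext)
  have "clinear (\<lambda>a. f (L a))" by (rule clinear_comp[OF assms(1) assms(2)])
  note * = left_slice[OF this]
  show "clinear (\<lambda>z. left_slice f (tensor_map L R z))" "clinear (\<lambda>z. R (left_slice (\<lambda>a. f (L a)) z))"
    by (rule clinear_comp[OF left_slice(1)[OF assms(1)] tensor_map(1)[OF assms(2,3)]]
        clinear_comp[OF assms(3) *(1)])+
  show "left_slice f (tensor_map L R (a \<otimes> b)) = R (left_slice (\<lambda>a. f (L a)) (a \<otimes> b))" for a b
    by (simp add: * tensor_map assms left_slice clinearD[OF assms(3)])
qed

lemma right_slice_tensor_map:
  assumes "clinear f" "clinear L" "clinear R"
  shows "right_slice f (tensor_map L R z) = L (right_slice (\<lambda>b. f (R b)) z)"
proof (rule tensor_ext)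
  have "clinear (\<lambda>a. f (R a))" by (rule clinear_comp[OF assms(1) assms(3)])
  note * = right_slice[OF this]
  show "clinear (\<lambda>z. right_slice f (tensor_map L R z))" "clinear (\<lambda>z. L (right_slice (\<lambda>a. f (R a)) z))"
    by (rule clinear_comp[OF right_slice(1)[OF assms(1)] tensor_map(1)[OF assms(2,3)]]
        clinear_comp[OF assms(2) *(1)])+
  show "right_slice f (tensor_map L R (a \<otimes> b)) = L (right_slice (\<lambda>a. f (R a)) (a \<otimes> b))" for a b
    by (simp add: * tensor_map assms right_slice clinearD[OF assms(2)])
qed

lemma left_slice_linear:
  assumes "clinear f" "clinear g"
  shows "left_slice (\<lambda>x. f x + g x) z = left_slice f z + left_slice g z"
    "left_slice (\<lambda>x. c * f x) z = c *\<^sub>C left_slice f z"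
proof -
  have fg: "clinear (\<lambda>x. f x + g x)" and cf: "clinear (\<lambda>x. c * f x)"
    using assms by (simp_all add: clinear_iff algebra_simps)
  note l = left_slice[OF assms(1)] left_slice[OF assms(2)] left_slice[OF fg] left_slice[OF cf]
  show "left_slice (\<lambda>x. f x + g x) z = left_slice f z + left_slice g z"
    "left_slice (\<lambda>x. c * f x) z = c *\<^sub>C left_slice f z"
    by (induction z rule: tensor_induct)
      (simp_all add: l clinearD[OF l(1)] clinearD[OF l(3)] clinearD[OF l(5)] clinearD[OF l(7)]
        scaleC_add_left scaleC_add_right)
qed

lemma slice_zero [simp]: "left_slice (\<lambda>_. 0) z = 0" "right_slice (\<lambda>_. 0) z = 0"
proof -
  have 0: "clinear (\<lambda>_ :: 'x::cvector_space. 0 :: complex)" by (simp add: clinear_iff)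
  show "left_slice (\<lambda>_. 0) z = 0" "right_slice (\<lambda>_. 0) z = 0"
    by (induction z rule: tensor_induct)
      (simp_all add: left_slice[OF 0] right_slice[OF 0] clinearD[OF left_slice(1)[OF 0]]
        clinearD[OF right_slice(1)[OF 0]])
qed

lemma tensor_map_linear:
  assumes "clinear f" "clinear f'" "clinear g" "clinear g'"
  shows "tensor_map (\<lambda>x. f x + f' x) g z = tensor_map f g z + tensor_map f' g z"
    "tensor_map f (\<lambda>x. g x + g' x) z = tensor_map f g z + tensor_map f g' z"
    "tensor_map (\<lambda>x. c *\<^sub>C f x) g z = c *\<^sub>C tensor_map f g z"
proof -
  have ff: "clinear (\<lambda>x. f x + f' x)" and cf: "clinear (\<lambda>x. c *\<^sub>C f x)"
    and gg: "clinear (\<lambda>x. g x + g' x)"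
    using assms by (simp_all add: clinear_iff algebra_simps scaleC_add_right)
  note m = tensor_map[OF assms(1,3)] tensor_map[OF assms(2,3)] tensor_map[OF assms(1,4)]
    tensor_map[OF ff assms(3)] tensor_map[OF cf assms(3)] tensor_map[OF assms(1) gg]
  show "tensor_map (\<lambda>x. f x + f' x) g z = tensor_map f g z + tensor_map f' g z"
    "tensor_map f (\<lambda>x. g x + g' x) z = tensor_map f g z + tensor_map f g' z"
    "tensor_map (\<lambda>x. c *\<^sub>C f x) g z = c *\<^sub>C tensor_map f g z"
    by (induction z rule: tensor_induct)
      (simp_all add: m clinearD[OF m(1)] clinearD[OF m(3)] clinearD[OF m(5)] clinearD[OF m(7)]
        clinearD[OF m(9)] clinearD[OF m(11)] scaleC_add_right tensor_add_left tensor_add_right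
        tensor_scaleC_left)
qed

text \<open>Choosing the first legs in a basis makes the second legs \<open>y e\<close> unique, so
  that slicing with coordinate functionals recovers them.\<close>

lemma tensor_expand_basis:
  fixes z :: "'a::cvector_space \<otimes> 'b::cvector_space"
  assumes B: "cvec.independent B" "cvec.span B = UNIV"
  shows "\<exists>F y. finite F \<and> F \<subseteq> B \<and> z = (\<Sum>e\<in>F. e \<otimes> y e)"
proof (induction z rule: tensor_induct)
  case (pure a b)
  let ?r = "cvec.representation B a"
  have fin: "finite {e. ?r e \<noteq> 0}" by (rule cvec.finite_representation)
  have "a = (\<Sum>e | ?r e \<noteq> 0. ?r e *\<^sub>C e)"
    using cvec.sum_nonzero_representation_eq[of B a] B by simp
  then have "a \<otimes> b = (\<Sum>e | ?r e \<noteq> 0. ?r e *\<^sub>C e) \<otimes> b" by simp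
  also have "\<dots> = (\<Sum>e | ?r e \<noteq> 0. (?r e *\<^sub>C e) \<otimes> b)"
    by (rule clinear_sum[of "\<lambda>a. a \<otimes> b"]) (simp add: clinear_iff tensor_add_left tensor_scaleC_left)
  finally have "a \<otimes> b = (\<Sum>e | ?r e \<noteq> 0. e \<otimes> (?r e *\<^sub>C b))"
    by (simp add: tensor_scaleC_left tensor_scaleC_right)
  moreover have "{e. ?r e \<noteq> 0} \<subseteq> B" using cvec.representation_ne_zero by auto
  ultimately show ?case using fin by (intro exI[of _ "{e. ?r e \<noteq> 0}"] exI[of _ "\<lambda>e. ?r e *\<^sub>C b"]) blast
next
  case (add x y)
  then obtain F p G q where F: "finite F" "F \<subseteq> B" "x = (\<Sum>e\<in>F. e \<otimes> p e)"
    and G: "finite G" "G \<subseteq> B" "y = (\<Sum>e\<in>G. e \<otimes> q e)" by blast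
  define p' q' where "p' e = (if e \<in> F then p e else 0)" and "q' e = (if e \<in> G then q e else 0)" for e
  have "x = (\<Sum>e\<in>F \<union> G. e \<otimes> p' e)"
    unfolding F using F G by (intro sum.mono_neutral_cong_left) (auto simp: p'_def)
  moreover have "y = (\<Sum>e\<in>F \<union> G. e \<otimes> q' e)"
    unfolding G using F G by (intro sum.mono_neutral_cong_left) (auto simp: q'_def)
  ultimately have "x + y = (\<Sum>e\<in>F \<union> G. e \<otimes> (p' e + q' e))"
    by (simp add: tensor_add_right sum.distrib)
  then show ?case using F G by (intro exI[of _ "F \<union> G"] exI[of _ "\<lambda>e. p' e + q' e"]) auto
qed

text \<open>In an expansion along a basis, the coordinate functional at \<open>e\<close> isolates
  the second leg \<open>y e\<close>, so each second leg is itself a slice of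
  \<open>z\<close>.\<close>

lemma mem_tensor_subspace_right:
  fixes z :: "'a::cvector_space \<otimes> 'b::cvector_space"
  assumes W: "cvec.subspace W" and z: "\<And>f. clinear f \<Longrightarrow> left_slice f z \<in> W"
  shows "z \<in> tensor_subspace UNIV W"
proof -
  define B :: "'a set" where "B = cvec.extend_basis {}"
  have B: "cvec.independent B" "cvec.span B = UNIV"
    using cvec.independent_extend_basis[of "{}"] cvec.span_extend_basis[of "{}"]
    by (simp_all add: B_def cvec.independent_empty)
  from tensor_expand_basis[OF B] obtain F y where F: "finite F" "F \<subseteq> B" and zF: "z = (\<Sum>e\<in>F. e \<otimes> y e)"
    by blast
  have "y e \<in> W" if e: "e \<in> F" for e
  proof -
    let ?f = "\<lambda>v. cvec.representation B v e"
    have f: "clinear ?f" by (rule clinear_representation) (rule B)+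
    have "left_slice ?f z = (\<Sum>e'\<in>F. ?f e' *\<^sub>C y e')"
      unfolding zF by (simp add: clinear_sum[OF left_slice(1)[OF f]] left_slice[OF f])
    also have "\<dots> = (\<Sum>e'\<in>F. if e' = e then y e' else 0)"
      using F B by (intro sum.cong) (auto simp: cvec.representation_basis subset_iff)
    finally show ?thesis using z[OF f] F e by simp
  qed
  then show ?thesis
    unfolding zF tensor_subspace_def by (intro cvec.span_sum cvec.span_base) auto
qed

lemma left_slices_separate:
  assumes "\<And>f. clinear f \<Longrightarrow> left_slice f z = 0"
  shows "z = 0"
proof -
  have "z \<in> tensor_subspace UNIV {0}"
    by (rule mem_tensor_subspace_right) (use assms in \<open>auto simp: cvec.subspace_single_0\<close>)
  moreover have "{v \<otimes> w |v w. v \<in> UNIV \<and> w \<in> {0}} = {0}" by auto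
  ultimately show ?thesis by (simp add: tensor_subspace_def)
qed

lemma right_slices_separate:
  fixes z :: "'a::cvector_space \<otimes> 'b::cvector_space"
  assumes "\<And>f. clinear f \<Longrightarrow> right_slice f z = 0"
  shows "z = 0"
proof (rule left_slices_separate)
  fix f :: "'a \<Rightarrow> complex" assume f: "clinear f"
  show "left_slice f z = 0"
    by (rule functionals_separate)
      (use assms f in \<open>simp add: left_slice_functional_right_slice clinearD\<close>)
qed

text \<open>Dual criterion: a slice \<open>left_slice g z\<close> outside \<open>W\<close> would be
  detected by a functional \<open>f\<close> vanishing on \<open>W\<close>, but the Fubini rule turns
  that value into \<open>g (right_slice f z) = 0\<close>.\<close>

lemma mem_tensor_subspace_right_annihilator:
  fixes z :: "'a::cvector_space \<otimes> 'b::cvector_space"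
  assumes W: "cvec.subspace W"
    and z: "\<And>f. clinear f \<Longrightarrow> (\<And>w. w \<in> W \<Longrightarrow> f w = 0) \<Longrightarrow> right_slice f z = 0"
  shows "z \<in> tensor_subspace UNIV W"
proof (rule mem_tensor_subspace_right[OF W], rule ccontr)
  fix g :: "'a \<Rightarrow> complex"
  assume g: "clinear g" and "left_slice g z \<notin> W"
  from functional_separates_subspace[OF W this(2)] obtain f :: "'b \<Rightarrow> complex"
    where f: "clinear f" "\<And>w. w \<in> W \<Longrightarrow> f w = 0" "f (left_slice g z) \<noteq> 0"
    by blast
  then show False using z g by (simp add: left_slice_functional_right_slice clinearD)
qed

lemma right_slice_swap:
  assumes "clinear f"
  shows "right_slice f (tensor_swap z) = left_slice f z"
  by (rule tensor_ext[OF clinear_comp[OF right_slice(1) tensor_swap(1)] left_slice(1)])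
    (simp_all add: assms tensor_swap left_slice right_slice)

lemma mem_tensor_subspace_left_annihilator:
  fixes z :: "'a::cvector_space \<otimes> 'b::cvector_space"
  assumes W: "cvec.subspace W"
    and z: "\<And>f. clinear f \<Longrightarrow> (\<And>w. w \<in> W \<Longrightarrow> f w = 0) \<Longrightarrow> left_slice f z = 0"
  shows "z \<in> tensor_subspace W UNIV"
proof -
  have "tensor_swap z \<in> tensor_subspace UNIV W"
  proof (rule mem_tensor_subspace_right_annihilator[OF W])
    fix f :: "'a \<Rightarrow> complex"
    assume "clinear f" "\<And>w. w \<in> W \<Longrightarrow> f w = 0"
    with z[of f] show "right_slice f (tensor_swap z) = 0" by (simp add: right_slice_swap)
  qed
  then have "tensor_swap (tensor_swap z) \<in> tensor_subspace W UNIV"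
    unfolding tensor_subspace_def
  proof (induction rule: cvec.span_induct_alt)
    case (step c x y)
    then obtain v w where "w \<in> W" "tensor_swap x = w \<otimes> v" by (auto simp: tensor_swap)
    then have "tensor_swap x \<in> {v \<otimes> w |v w. v \<in> W \<and> w \<in> UNIV}" by blast
    then show ?case
      using step by (simp only: clinearD[OF tensor_swap(1)] cvec.span_add cvec.span_scale cvec.span_base)
  qed (simp add: clinearD[OF tensor_swap(1)] cvec.span_zero)
  then show ?thesis by simp
qed

text \<open>Finite-dimensional duality in which the coordinate functionals must come from a
  prescribed separating space \<open>F\<close> instead of the full dual. Induction on a spanning
  set: \<open>W\<close> is cut down to its part in \<open>cvec.span Y\<close>, which has codimension
  at most one, and the missing direction is added back.\<close>

lemma separating_functionals_dual_basis:
  fixes W :: "'a::cvector_space set" and F :: "('a \<Rightarrow> complex) set"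
  assumes "finite Y" "cvec.subspace W" "W \<subseteq> cvec.span Y"
    and F: "\<And>f. f \<in> F \<Longrightarrow> clinear f" "(\<lambda>_. 0) \<in> F"
      "\<And>f g. f \<in> F \<Longrightarrow> g \<in> F \<Longrightarrow> (\<lambda>x. f x + g x) \<in> F"
      "\<And>f c. f \<in> F \<Longrightarrow> (\<lambda>x. c * f x) \<in> F"
    and sep: "\<And>w. w \<in> W \<Longrightarrow> (\<And>f. f \<in> F \<Longrightarrow> f w = 0) \<Longrightarrow> w = 0"
  shows "\<exists>(n::nat) f y. (\<forall>i<n. f i \<in> F \<and> y i \<in> W) \<and> (\<forall>w\<in>W. w = (\<Sum>i<n. f i w *\<^sub>C y i))"
  using assms(1-3) sep
proof (induction Y arbitrary: W rule: finite_induct)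
  case empty
  then show ?case by (intro exI[of _ 0]) auto
next
  case (insert y0 Y)
  show ?case
  proof (cases "W \<subseteq> cvec.span Y")
    case True
    then show ?thesis using insert by blast
  next
    case False
    then obtain w where w: "w \<in> W" "w \<notin> cvec.span Y" by auto
    have sub: "cvec.subspace (W \<inter> cvec.span Y)"
      using insert.prems(1) by (simp add: cvec.subspace_inter)
    have decomp: "\<exists>l. v - l *\<^sub>C w \<in> W \<inter> cvec.span Y" if v: "v \<in> W" for v
    proof -
      from w insert.prems(2) obtain k where k: "w - k *\<^sub>C y0 \<in> cvec.span Y"
        using cvec.span_breakdown_eq by blast
      from v insert.prems(2) obtain m where m: "v - m *\<^sub>C y0 \<in> cvec.span Y"
        using cvec.span_breakdown_eq by blast
      have "k \<noteq> 0" using k w by auto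
      then have "v - (m / k) *\<^sub>C w = (v - m *\<^sub>C y0) - (m / k) *\<^sub>C (w - k *\<^sub>C y0)"
        by (simp add: cvec.scale_right_diff_distrib)
      then have "v - (m / k) *\<^sub>C w \<in> cvec.span Y"
        using k m by (simp only: cvec.span_diff cvec.span_scale)
      then show ?thesis
        using insert.prems(1) v w by (auto intro!: cvec.subspace_diff cvec.subspace_scale)
    qed
    have "\<exists>(n::nat) f y. (\<forall>i<n. f i \<in> F \<and> y i \<in> W \<inter> cvec.span Y) \<and>
        (\<forall>w\<in>W \<inter> cvec.span Y. w = (\<Sum>i<n. f i w *\<^sub>C y i))"
      by (rule insert.IH[OF sub]) (use insert.prems(3) in auto)
    then obtain n :: nat and f y where fy: "\<And>i. i < n \<Longrightarrow> f i \<in> F" "\<And>i. i < n \<Longrightarrow> y i \<in> W \<inter> cvec.span Y"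
      and sum: "\<And>v. v \<in> W \<inter> cvec.span Y \<Longrightarrow> v = (\<Sum>i<n. f i v *\<^sub>C y i)"
      by blast
    \<comment> \<open>\<open>w'\<close> differs from \<open>w\<close> by an element of
      \<open>W \<inter> cvec.span Y\<close>; since \<open>w\<close> is not in that space,
      \<open>w'\<close> is nonzero and some \<open>f0\<close> in \<open>F\<close> detects
      it.\<close>
    define w' where "w' = w - (\<Sum>i<n. f i w *\<^sub>C y i)"
    have "(\<Sum>i<n. f i w *\<^sub>C y i) \<in> W \<inter> cvec.span Y"
      using fy(2) by (intro cvec.subspace_sum[OF sub] cvec.subspace_scale[OF sub]) auto
    then have "w' \<in> W" "w' \<noteq> 0"
      using w insert.prems(1) by (auto simp: w'_def cvec.subspace_diff)
    then obtain f0 where f0: "f0 \<in> F" "f0 w' \<noteq> 0" using insert.prems(3) by blast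
    \<comment> \<open>On \<open>W \<inter> cvec.span Y\<close> the expansion of \<open>v\<close>
      gives \<open>f0 v = (\<Sum>i<n. f0 (y i) * f i v)\<close>, so \<open>h\<close> vanishes there,
      while the normalisation by \<open>f0 w'\<close> gives \<open>h w = 1\<close>. The form is
      chosen so that the closure properties of \<open>F\<close> apply.\<close>
    define h where "h x = (1 / f0 w') * (f0 x + (-1) * (\<Sum>i<n. f0 (y i) * f i x))" for x
    have sumF: "(\<lambda>x. \<Sum>i<m. c i * f i x) \<in> F" if "m \<le> n" for m c
      using that by (induction m) (use F fy in auto)
    have hF: "h \<in> F"
      unfolding h_def by (intro F(3,4) f0(1) sumF order_refl)
    note lf0 = clinearD[OF F(1)[OF f0(1)]] and lh = clinearD[OF F(1)[OF hF]]
    have f0sum: "f0 (\<Sum>i<n. f i v *\<^sub>C y i) = (\<Sum>i<n. f0 (y i) * f i v)" for v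
      by (simp add: clinear_sum[OF F(1)[OF f0(1)]] lf0 mult.commute)
    have h0: "h v = 0" if "v \<in> W \<inter> cvec.span Y" for v
      using sum[OF that] f0sum[of v] by (simp add: h_def)
    have h1: "h w = 1"
      using f0(2) by (simp add: h_def w'_def lf0 f0sum)
    \<comment> \<open>The correction by \<open>h\<close> makes the old functionals vanish at
      \<open>w\<close> without changing them on \<open>W \<inter> cvec.span Y\<close>; the pair of
      \<open>h\<close> and \<open>w\<close> accounts for the remaining direction.\<close>
    define f' y' where "f' i = (if i < n then (\<lambda>x. f i x + (- f i w) * h x) else h)"
      and "y' i = (if i < n then y i else w)" for i
    have "(\<lambda>x. f i x + (- f i w) * h x) \<in> F" if "i < n" for i
      by (intro F(3,4) fy(1) hF that)
    then have "f' i \<in> F \<and> y' i \<in> W" if "i < Suc n" for i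
      unfolding f'_def y'_def using fy(2) hF w by auto
    moreover have "v = (\<Sum>i<Suc n. f' i v *\<^sub>C y' i)" if v: "v \<in> W" for v
    proof -
      obtain l where l: "v - l *\<^sub>C w \<in> W \<inter> cvec.span Y" using decomp[OF v] by blast
      have "h v = l" using h0[OF l] h1 by (simp add: lh)
      then have "v - h v *\<^sub>C w = (\<Sum>i<n. f i (v - h v *\<^sub>C w) *\<^sub>C y i)" using sum l by simp
      also have "\<dots> = (\<Sum>i<n. f' i v *\<^sub>C y' i)"
        using fy F(1) by (intro sum.cong) (simp_all add: f'_def y'_def clinearD mult.commute)
      finally show ?thesis by (simp add: f'_def y'_def algebra_simps)
    qed
    ultimately show ?thesis by (intro exI[of _ "Suc n"] exI[of _ f'] exI[of _ y']) blast
  qed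
qed

section \<open>Multipliers of non-degenerate algebras\<close>

lemma nondegenerate_cancel:
  fixes x y :: "'a::calgebra"
  assumes "nondegenerate_algebra TYPE('a)"
  shows "(\<And>c. c * x = c * y) \<Longrightarrow> x = y" "(\<And>c. x * c = y * c) \<Longrightarrow> x = y"
proof -
  have "(\<forall>b. b * (x - y) = 0) \<longrightarrow> x - y = 0" "(\<forall>b. (x - y) * b = 0) \<longrightarrow> x - y = 0"
    using assms unfolding nondegenerate_algebra_def by blast+
  then show "(\<And>c. c * x = c * y) \<Longrightarrow> x = y" "(\<And>c. x * c = y * c) \<Longrightarrow> x = y"
    by (auto simp: right_diff_distrib left_diff_distrib)
qed

text \<open>After multiplication by \<open>c\<close> on the left, \<open>m\<close> acts on
  \<open>c\<close> from the right and no longer interferes with \<open>n\<close>; non-degeneracy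
  then cancels \<open>c\<close>.\<close>

lemma multiplier_assoc:
  fixes m n :: "'a::calgebra multiplier"
  assumes "nondegenerate_algebra TYPE('a)"
  shows "(m \<rhd> a) \<lhd> n = m \<rhd> (a \<lhd> n)"
proof (rule nondegenerate_cancel(1)[OF assms])
  fix c
  have "c * ((m \<rhd> a) \<lhd> n) = ((c \<lhd> m) * a) \<lhd> n"
    by (simp add: multiplier_module(2)[symmetric] multiplier_module(3))
  also have "\<dots> = c * (m \<rhd> (a \<lhd> n))"
    by (simp add: multiplier_module(2,3))
  finally show "c * ((m \<rhd> a) \<lhd> n) = c * (m \<rhd> (a \<lhd> n))" .
qed

lemma multiplier_eq_leftI:
  fixes m n :: "'a::calgebra multiplier"
  assumes "nondegenerate_algebra TYPE('a)" "\<And>a. m \<rhd> a = n \<rhd> a"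
  shows "m = n"
proof (rule multiplier_eqI)
  show "a \<lhd> m = a \<lhd> n" for a
    by (rule nondegenerate_cancel(2)[OF assms(1)])
      (simp add: multiplier_module(3)[symmetric] assms(2))
qed (rule assms(2))

lemma multiplier_eq_rightI:
  fixes m n :: "'a::calgebra multiplier"
  assumes "nondegenerate_algebra TYPE('a)" "\<And>a. a \<lhd> m = a \<lhd> n"
  shows "m = n"
proof (rule multiplier_eqI)
  show "m \<rhd> a = n \<rhd> a" for a
    by (rule nondegenerate_cancel(1)[OF assms(1)])
      (simp add: multiplier_module(3) assms(2))
qed (rule assms(2))

text \<open>Compatibility of the two actions suffices: linearity and the module rules for
  \<open>L\<close> become trivial identities for \<open>R\<close> after multiplying on the left, and
  conversely.\<close>

lemma multiplier_exists:
  fixes L R :: "'a::calgebra \<Rightarrow> 'a"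
  assumes nd: "nondegenerate_algebra TYPE('a)" and LR: "\<And>a b. a * L b = R a * b"
  shows "\<exists>m. (\<forall>a. m \<rhd> a = L a) \<and> (\<forall>a. a \<lhd> m = R a)"
proof -
  note cancel = nondegenerate_cancel[OF nd]
  have "clinear L"
    by (rule clinearI; rule cancel(1)) (simp_all add: LR distrib_left)
  moreover have "clinear R"
    by (rule clinearI; rule cancel(2)) (simp_all add: LR[symmetric] distrib_right)
  moreover have "L (a * b) = L a * b" for a b
    by (rule cancel(1)) (simp add: LR mult.assoc[symmetric])
  moreover have "R (a * b) = a * R b" for a b
    by (rule cancel(2)) (simp add: LR[symmetric] mult.assoc)
  ultimately have "(L, R) \<in> double_centralizers"
    using LR by (simp add: double_centralizers_def)
  then have "Rep_multiplier (Abs_multiplier (L, R)) = (L, R)"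
    by (rule Abs_multiplier_inverse)
  then show ?thesis
    by (intro exI[of _ "Abs_multiplier (L, R)"]) (simp add: mult_left.rep_eq mult_right.rep_eq)
qed

lemma mult_of_hom:
  "mult_of (a + b) = mult_of a + mult_of b" "mult_of (c *\<^sub>C a) = c *\<^sub>C mult_of a"
  "mult_of (a * b) = mult_of a * mult_of b"
  "mult_of (m \<rhd> a) = m * mult_of a" "mult_of (a \<lhd> m) = mult_of a * m"
  by (rule multiplier_eqI;
      simp add: distrib_left distrib_right mult.assoc multiplier_module)+

lemma inj_mult_of: "nondegenerate_algebra TYPE('a) \<Longrightarrow> inj (mult_of :: 'a::calgebra \<Rightarrow> _)"
  by (rule injI, rule nondegenerate_cancel(1)) (auto dest: arg_cong[of _ _ "\<lambda>m. _ \<lhd> m"])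

lemma as_element_mult_of:
  "nondegenerate_algebra TYPE('a) \<Longrightarrow> as_element (mult_of a) = (a :: 'a::calgebra)"
  by (simp add: as_element_def inj_mult_of inv_f_f)

lemma mult_of_as_element: "m \<in> range mult_of \<Longrightarrow> mult_of (as_element m) = m"
  by (simp add: as_element_def f_inv_into_f)

lemma mult_tensor_linear:
  "(m + m') \<boxtimes> n = m \<boxtimes> n + m' \<boxtimes> n" "m \<boxtimes> (n + n') = m \<boxtimes> n + m \<boxtimes> n'"
  "(c *\<^sub>C m) \<boxtimes> n = c *\<^sub>C (m \<boxtimes> n)" "m \<boxtimes> (c *\<^sub>C n) = c *\<^sub>C (m \<boxtimes> n)"
  by (rule multiplier_tensor_eqI;
      simp add: tensor_add_left tensor_add_right tensor_scaleC_left tensor_scaleC_right)+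

lemma mult_tensor_apply:
  "(m \<boxtimes> n) \<rhd> z = tensor_map (\<lambda>a. m \<rhd> a) (\<lambda>b. n \<rhd> b) z"
  "z \<lhd> (m \<boxtimes> n) = tensor_map (\<lambda>a. a \<lhd> m) (\<lambda>b. b \<lhd> n) z"
   by (rule tensor_ext; simp add: clinear_mult_left' clinear_mult_right' tensor_map)+

lemma left_slice_mult_tensor:
  assumes "clinear f"
  shows "left_slice f ((m \<boxtimes> n) \<rhd> z) = n \<rhd> left_slice (\<lambda>a. f (m \<rhd> a)) z"
    "left_slice f (z \<lhd> (m \<boxtimes> n)) = left_slice (\<lambda>a. f (a \<lhd> m)) z \<lhd> n"
  by (simp_all add: mult_tensor_apply left_slice_tensor_map assms clinear_mult_left' clinear_mult_right')

lemma right_slice_mult_tensor: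
  assumes "clinear f"
  shows "right_slice f ((m \<boxtimes> n) \<rhd> z) = m \<rhd> right_slice (\<lambda>a. f (n \<rhd> a)) z"
    "right_slice f (z \<lhd> (m \<boxtimes> n)) = right_slice (\<lambda>a. f (a \<lhd> n)) z \<lhd> m"
  by (simp_all add: mult_tensor_apply right_slice_tensor_map assms clinear_mult_left' clinear_mult_right')

text \<open>Slicing the second leg reduces this to cancellation in \<open>A\<close>. It removes the
  covering factors under which most Sweedler formulas are stated.\<close>

lemma tensor_cancel_first:
  fixes x y :: "'a::calgebra \<otimes> 'b::calgebra"
  assumes nd: "nondegenerate_algebra TYPE('a)"
  shows "(\<And>c. (mult_of c \<boxtimes> 1) \<rhd> x = (mult_of c \<boxtimes> 1) \<rhd> y) \<Longrightarrow> x = y"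
    "(\<And>c. x \<lhd> (mult_of c \<boxtimes> 1) = y \<lhd> (mult_of c \<boxtimes> 1)) \<Longrightarrow> x = y"
proof -
  have "x = y" if *: "\<And>f. clinear f \<Longrightarrow> right_slice f x = right_slice f y"
    using right_slices_separate[of "x - y"] *
    by (simp add: clinearD(5)[OF right_slice(1)])
  note sep = this
  show "x = y" if *: "\<And>c. (mult_of c \<boxtimes> 1) \<rhd> x = (mult_of c \<boxtimes> 1) \<rhd> y"
  proof (rule sep, rule nondegenerate_cancel(1)[OF nd])
    show "c * right_slice f x = c * right_slice f y" if "clinear f" for c f
      using arg_cong[OF *[of c], of "right_slice f"] that by (simp add: right_slice_mult_tensor)
  qed
  show "x = y" if *: "\<And>c. x \<lhd> (mult_of c \<boxtimes> 1) = y \<lhd> (mult_of c \<boxtimes> 1)"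
  proof (rule sep, rule nondegenerate_cancel(2)[OF nd])
    show "right_slice f x * c = right_slice f y * c" if "clinear f" for c f
      using arg_cong[OF *[of c], of "right_slice f"] that by (simp add: right_slice_mult_tensor)
  qed
qed

lemma tensor_cancel_second:
  fixes x y :: "'a::calgebra \<otimes> 'b::calgebra"
  assumes nd: "nondegenerate_algebra TYPE('b)"
  shows "(\<And>c. (1 \<boxtimes> mult_of c) \<rhd> x = (1 \<boxtimes> mult_of c) \<rhd> y) \<Longrightarrow> x = y"
    "(\<And>c. x \<lhd> (1 \<boxtimes> mult_of c) = y \<lhd> (1 \<boxtimes> mult_of c)) \<Longrightarrow> x = y"
proof -
  have "x = y" if *: "\<And>f. clinear f \<Longrightarrow> left_slice f x = left_slice f y"
    using left_slices_separate[of "x - y"] *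
    by (simp add: clinearD(5)[OF left_slice(1)])
  note sep = this
  show "x = y" if *: "\<And>c. (1 \<boxtimes> mult_of c) \<rhd> x = (1 \<boxtimes> mult_of c) \<rhd> y"
  proof (rule sep, rule nondegenerate_cancel(1)[OF nd])
    show "c * left_slice f x = c * left_slice f y" if "clinear f" for c f
      using arg_cong[OF *[of c], of "left_slice f"] that by (simp add: left_slice_mult_tensor)
  qed
  show "x = y" if *: "\<And>c. x \<lhd> (1 \<boxtimes> mult_of c) = y \<lhd> (1 \<boxtimes> mult_of c)"
  proof (rule sep, rule nondegenerate_cancel(2)[OF nd])
    show "left_slice f x * c = left_slice f y * c" if "clinear f" for c f
      using arg_cong[OF *[of c], of "left_slice f"] that by (simp add: left_slice_mult_tensor)
  qed
qed

lemma pure_tensor_mult: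
  "(a \<otimes> b) * z = (1 \<boxtimes> mult_of b) \<rhd> (mult_of a \<boxtimes> 1) \<rhd> z"
  "z * (a \<otimes> b) = z \<lhd> (mult_of a \<boxtimes> 1) \<lhd> (1 \<boxtimes> mult_of b)"
proof -
  have "(a \<otimes> b) * z = ((1 \<boxtimes> mult_of b) * (mult_of a \<boxtimes> 1)) \<rhd> z"
    "z * (a \<otimes> b) = z \<lhd> ((mult_of a \<boxtimes> 1) * (1 \<boxtimes> mult_of b))"
    by (simp_all only: mult_tensor_times mult_1_left mult_1_right mult_of_pure_tensor[symmetric] mult_of_simps)
  then show "(a \<otimes> b) * z = (1 \<boxtimes> mult_of b) \<rhd> (mult_of a \<boxtimes> 1) \<rhd> z"
    "z * (a \<otimes> b) = z \<lhd> (mult_of a \<boxtimes> 1) \<lhd> (1 \<boxtimes> mult_of b)"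
    by simp_all
qed

lemma tensor_mult_cancel:
  fixes x y :: "'a::calgebra \<otimes> 'b::calgebra"
  assumes "nondegenerate_algebra TYPE('a)" "nondegenerate_algebra TYPE('b)"
  shows "(\<And>a b. (a \<otimes> b) * x = (a \<otimes> b) * y) \<Longrightarrow> x = y"
    "(\<And>a b. x * (a \<otimes> b) = y * (a \<otimes> b)) \<Longrightarrow> x = y"
  unfolding pure_tensor_mult
  by (rule tensor_cancel_first(1)[OF assms(1)], rule tensor_cancel_second(1)[OF assms(2)], assumption)
    (rule tensor_cancel_first(2)[OF assms(1)], rule tensor_cancel_second(2)[OF assms(2)], assumption)

lemma nondegenerate_tensor:
  assumes "nondegenerate_algebra TYPE('a::calgebra)" "nondegenerate_algebra TYPE('b::calgebra)"
  shows "nondegenerate_algebra TYPE('a \<otimes> 'b)"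
  unfolding nondegenerate_algebra_def
proof (intro conjI allI impI)
  fix x :: "'a \<otimes> 'b"
  show "x = 0" if "\<forall>b. x * b = 0"
    by (rule tensor_mult_cancel(2)[OF assms]) (simp add: that)
  show "x = 0" if "\<forall>b. b * x = 0"
    by (rule tensor_mult_cancel(1)[OF assms]) (simp add: that)
qed

lemma tensor3_mult_cancel:
  fixes x y :: "'a::calgebra \<otimes> 'b::calgebra \<otimes> 'c::calgebra"
  assumes "nondegenerate_algebra TYPE('a)" "nondegenerate_algebra TYPE('b)" "nondegenerate_algebra TYPE('c)"
    and "\<And>a b c. x * (a \<otimes> b \<otimes> c) = y * (a \<otimes> b \<otimes> c)"
  shows "x = y"
proof (rule tensor_mult_cancel(2)[OF assms(1) nondegenerate_tensor[OF assms(2,3)]])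
  fix a and z :: "'b \<otimes> 'c"
  show "x * (a \<otimes> z) = y * (a \<otimes> z)"
    by (induction z rule: tensor_induct) (simp_all add: assms(4) tensor_add_right distrib_left)
qed

lemma leg12_pure_left: "leg12 X \<rhd> (a \<otimes> b \<otimes> c) = tensor_assoc ((X \<rhd> (a \<otimes> b)) \<otimes> c)"
  by (simp add: leg12_def mult_assoc_apply tensor_assoc)

lemma tensor_assoc_mult_first: "tensor_assoc (((m \<boxtimes> 1) \<rhd> z) \<otimes> t) = (m \<boxtimes> 1) \<rhd> tensor_assoc (z \<otimes> t)"
  by (induction z rule: tensor_induct)
    (simp_all add: tensor_assoc tensor_add_left clinearD[OF clinear_mult_left'] clinearD[OF tensor_assoc(1)])

lemma tensor_assoc_map_second:
  assumes "clinear g"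
  shows "tensor_assoc (tensor_map (\<lambda>x. x) g z \<otimes> t) = tensor_map (\<lambda>x. x) (\<lambda>v. g v \<otimes> t) z"
proof -
  have g: "clinear (\<lambda>v. g v \<otimes> t)"
    by (simp add: clinear_iff clinearD[OF assms] tensor_add_left tensor_scaleC_left)
  show ?thesis
    by (induction z rule: tensor_induct)
      (simp_all add: tensor_assoc tensor_add_left tensor_map[OF clinear_id assms] tensor_map[OF clinear_id g]
        clinearD[OF tensor_assoc(1)] clinearD[OF tensor_map(1)[OF clinear_id assms]]
        clinearD[OF tensor_map(1)[OF clinear_id g]])
qed

section \<open>The canonical maps and the target map\<close>

text \<open>The coproduct axioms put both products into \<open>A \<otimes> A\<close>, so
  \<open>as_element\<close> is meaningful on them. Bilinearity is checked in the multiplier algebra,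
  where it is evident, and pulled back along the injective \<open>mult_of\<close>.\<close>

lemma (in coproduct)
  assumes nd: "nondegenerate_algebra TYPE('a)"
  shows T1_props: "clinear (T1 \<Delta>)" "mult_of (T1 \<Delta> (a \<otimes> b)) = \<Delta> a * (1 \<boxtimes> mult_of b)"
    and T2_props: "clinear (T2 \<Delta>)" "mult_of (T2 \<Delta> (a \<otimes> b)) = (mult_of a \<boxtimes> 1) * \<Delta> b"
proof -
  have inj: "m = n" if "mult_of m = mult_of n" for m n :: "'a \<otimes> 'a"
    using inj_mult_of[OF nondegenerate_tensor[OF nd nd]] that by (simp add: inj_def)
  define \<beta>1 \<beta>2 where "\<beta>1 a b = as_element (\<Delta> a * (1 \<boxtimes> mult_of b))"
    and "\<beta>2 a b = as_element ((mult_of a \<boxtimes> 1) * \<Delta> b)" for a b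
  have \<beta>: "mult_of (\<beta>1 a b) = \<Delta> a * (1 \<boxtimes> mult_of b)" "mult_of (\<beta>2 a b) = (mult_of a \<boxtimes> 1) * \<Delta> b" for a b
    unfolding \<beta>1_def \<beta>2_def by (rule mult_of_as_element, rule Delta_right Delta_left)+
  have b1: "cbilinear \<beta>1" and b2: "cbilinear \<beta>2"
    by (rule cbilinearI; rule inj;
      simp add: \<beta> mult_of_hom mult_tensor_linear clinearD[OF Delta_linear] distrib_left distrib_right)+
  show "clinear (T1 \<Delta>)" "mult_of (T1 \<Delta> (a \<otimes> b)) = \<Delta> a * (1 \<boxtimes> mult_of b)"
    unfolding T1_def \<beta>1_def[symmetric] by (simp_all add: tensor_lift[OF b1] \<beta>)
  show "clinear (T2 \<Delta>)" "mult_of (T2 \<Delta> (a \<otimes> b)) = (mult_of a \<boxtimes> 1) * \<Delta> b"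
    unfolding T2_def \<beta>2_def[symmetric] by (simp_all add: tensor_lift[OF b2] \<beta>)
qed

context weak_multiplier_Hopf_algebra
begin

sublocale coproduct \<Delta>
  using full by (simp add: full_coproduct_def)

lemmas T1_linear = T1_props(1)[OF nondegenerate] and mult_of_T1 = T1_props(2)[OF nondegenerate]
  and T2_linear = T2_props(1)[OF nondegenerate] and mult_of_T2 = T2_props(2)[OF nondegenerate]

lemmas nondegenerate2 = nondegenerate_tensor[OF nondegenerate nondegenerate]

lemma T1_times: "T1 \<Delta> (a \<otimes> b) * z = \<Delta> a \<rhd> (1 \<boxtimes> mult_of b) \<rhd> z"
  using arg_cong[OF mult_of_T1[of a b], of "\<lambda>m. m \<rhd> z"] by simp

lemma E_T1: "E \<rhd> T1 \<Delta> z = T1 \<Delta> z"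
proof -
  obtain w where w: "T1 \<Delta> z = E \<rhd> w" using range_T1 by blast
  show ?thesis unfolding w using E_idem mult_left_simps(7)[of E E w] by simp
qed

text \<open>\<open>E\<close> fixes the range of \<open>T1\<close>, and multiplying
  \<open>\<Delta> a \<rhd> (r \<otimes> b)\<close> by \<open>p \<otimes> q\<close> on the right
  brings it to the form \<open>T1 \<Delta> (a \<otimes> b)\<close> times an element of
  \<open>A \<otimes> A\<close>.\<close>

lemma E_Delta: "E \<rhd> \<Delta> a \<rhd> z = \<Delta> a \<rhd> z"
proof (induction z rule: tensor_induct)
  case (pure r b)
  show ?case
  proof (rule tensor_mult_cancel(2)[OF nondegenerate nondegenerate])
    fix p q
    have *: "(\<Delta> a \<rhd> (r \<otimes> b)) * (p \<otimes> q) = T1 \<Delta> (a \<otimes> b) * ((r * p) \<otimes> q)"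
      by (simp add: multiplier_module(1)[symmetric] times_pure_tensor T1_times)
    then show "(E \<rhd> \<Delta> a \<rhd> (r \<otimes> b)) * (p \<otimes> q) = (\<Delta> a \<rhd> (r \<otimes> b)) * (p \<otimes> q)"
      by (metis E_T1 multiplier_module(1))
  qed
qed (simp add: clinearD[OF clinear_mult_left'])

text \<open>Fullness as a proof principle: a linear condition on \<open>q\<close> holds on all of
  \<open>A\<close> once it holds for the second legs of all
  \<open>(c \<otimes> 1)\<Delta>(a)\<close>.\<close>

lemma right_leg_slices:
  assumes W: "cvec.subspace W"
    and slices: "\<And>f c a. clinear f \<Longrightarrow> left_slice f (T2 \<Delta> (c \<otimes> a)) \<in> W"
  shows "q \<in> W"
proof -
  have "T2 \<Delta> (a \<otimes> b) \<in> tensor_subspace UNIV W" for a b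
    by (rule mem_tensor_subspace_right[OF W slices])
  then have "right_leg \<Delta> \<subseteq> W"
    using W unfolding right_leg_def by blast
  then show ?thesis using full by (auto simp: full_coproduct_def)
qed

text \<open>Both sides are \<open>(d \<otimes> 1)\<Delta>(a)(1 \<otimes> b)\<close>; this passes
  from one covering of \<open>\<Delta>(a)\<close> to the other.\<close>

lemma mult_T1_eq_T2_mult:
  "(mult_of d \<boxtimes> 1) \<rhd> T1 \<Delta> (a \<otimes> b) = T2 \<Delta> (d \<otimes> a) \<lhd> (1 \<boxtimes> mult_of b)"
proof -
  have "mult_of ((mult_of d \<boxtimes> 1) \<rhd> T1 \<Delta> (a \<otimes> b)) = mult_of (T2 \<Delta> (d \<otimes> a) \<lhd> (1 \<boxtimes> mult_of b))"
    by (simp only: mult_of_hom mult_of_T1 mult_of_T2 mult.assoc)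
  then show ?thesis using inj_mult_of[OF nondegenerate2] by (simp add: inj_def)
qed

end

section \<open>The target map as a multiplier, and covered Sweedler formulas for
  \<open>E\<close>\<close>

context antipode
begin

lemma cbilinear_mult_S: "cbilinear (\<lambda>p q. p \<lhd> S q)" and cbilinear_S_mult: "cbilinear (\<lambda>p q. S p \<rhd> q)"
  by (rule cbilinearI; simp add: clinearD[OF S_linear] clinearD[OF clinear_mult_left']
      clinearD[OF clinear_mult_right'])+

lemma clinear_mult_eps_t: "clinear (\<lambda>a. mult_eps_t \<Delta> S c a)"
  unfolding mult_eps_t_def
  by (rule clinear_comp[OF tensor_lift(1)[OF cbilinear_mult_S]],
      simp add: clinear_iff tensor_add_left tensor_add_right tensor_scaleC_left tensor_scaleC_right
        clinearD[OF T2_linear])+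

lemma clinear_eps_s_mult: "clinear (\<lambda>a. eps_s_mult \<Delta> S a c)"
  unfolding eps_s_mult_def
  by (rule clinear_comp[OF tensor_lift(1)[OF cbilinear_S_mult]],
      simp add: clinear_iff tensor_add_left tensor_add_right tensor_scaleC_left tensor_scaleC_right
        clinearD[OF T1_linear])+

text \<open>This justifies the definite description in \<open>eps_t\<close>. The Sweedler formula
  for \<open>E\<close> supplies the left action when \<open>q\<close> is a second leg of some
  \<open>T2 \<Delta> (c \<otimes> a)\<close>; fullness extends this to all \<open>q\<close>.\<close>

lemma eps_t_exists: "\<exists>m. \<forall>c. c \<lhd> m = mult_eps_t \<Delta> S c q"
proof -
  let ?W = "{q. \<exists>m. \<forall>c. c \<lhd> m = mult_eps_t \<Delta> S c q}"
  have "q \<in> ?W"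
  proof (rule right_leg_slices)
    note l = clinearD[OF clinear_mult_eps_t]
    show "cvec.subspace ?W"
    proof (rule cvec.subspaceI)
      show "0 \<in> ?W" by (auto simp: l intro!: exI[of _ 0])
      show "x + y \<in> ?W" if xy: "x \<in> ?W" "y \<in> ?W" for x y
      proof -
        from xy obtain m n where "\<forall>c. c \<lhd> m = mult_eps_t \<Delta> S c x" "\<forall>c. c \<lhd> n = mult_eps_t \<Delta> S c y"
          by auto
        then show ?thesis by (auto simp: l intro!: exI[of _ "m + n"])
      qed
      show "k *\<^sub>C x \<in> ?W" if x: "x \<in> ?W" for x k
      proof -
        from x obtain m where "\<forall>c. c \<lhd> m = mult_eps_t \<Delta> S c x"
          by auto
        then show ?thesis by (auto simp: l intro!: exI[of _ "k *\<^sub>C m"])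
      qed
    qed
  next
    fix f :: "'a \<Rightarrow> complex" and c a :: 'a
    assume f: "clinear f"
    \<comment> \<open>The slice of \<open>(c \<otimes> 1)E(a \<otimes> b)\<close> plays the role of
      \<open>\<epsilon>\<^sub>t(?q) b\<close>, the left action of the multiplier sought.\<close>
    let ?L = "\<lambda>b. left_slice f ((mult_of c \<boxtimes> 1) \<rhd> E \<rhd> (a \<otimes> b))"
    let ?q = "left_slice f (T2 \<Delta> (c \<otimes> a))"
    have "d * ?L b = mult_eps_t \<Delta> S d ?q * b" for d b
    proof -
      have lin: "clinear (\<lambda>q. mult_eps_t \<Delta> S d q * b)"
        by (rule clinear_comp[OF clinear_mult_right clinear_mult_eps_t])
      have "d * ?L b = left_slice f ((1 \<boxtimes> mult_of d) \<rhd> (mult_of c \<boxtimes> 1) \<rhd> E \<rhd> (a \<otimes> b))"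
        by (simp add: left_slice_mult_tensor f)
      also have "\<dots> = left_slice f (tensor_map (\<lambda>x. x) (\<lambda>q. mult_eps_t \<Delta> S d q * b) (T2 \<Delta> (c \<otimes> a)))"
        by (simp only: pure_tensor_mult[symmetric] S_E_left tensor_map_def)
      also have "\<dots> = mult_eps_t \<Delta> S d ?q * b"
        by (simp add: left_slice_tensor_map[OF f clinear_id lin])
      finally show ?thesis .
    qed
    then show "?q \<in> ?W"
      using multiplier_exists[OF nondegenerate, of ?L "\<lambda>d. mult_eps_t \<Delta> S d ?q"] by blast
  qed
  then show ?thesis by simp
qed

lemma mult_right_eps_t: "c \<lhd> eps_t \<Delta> S q = mult_eps_t \<Delta> S c q"
proof -
  obtain m where m: "\<forall>c. c \<lhd> m = mult_eps_t \<Delta> S c q" using eps_t_exists by blast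
  have "\<forall>c. c \<lhd> eps_t \<Delta> S q = mult_eps_t \<Delta> S c q"
    unfolding eps_t_def
  proof (rule theI)
    show "\<forall>c. c \<lhd> m = mult_eps_t \<Delta> S c q" by (rule m)
    show "n = m" if "\<forall>c. c \<lhd> n = mult_eps_t \<Delta> S c q" for n
      by (rule multiplier_eq_rightI[OF nondegenerate]) (simp add: that m)
  qed
  then show ?thesis by blast
qed

lemma clinear_eps_t: "clinear (eps_t \<Delta> S)"
  by (rule clinearI; rule multiplier_eq_rightI[OF nondegenerate])
    (simp_all add: mult_right_eps_t clinearD[OF clinear_mult_eps_t])

lemma clinear_eps_t_apply: "clinear (\<lambda>q. eps_t \<Delta> S q \<rhd> b)"
  by (rule clinearI) (simp_all add: clinearD[OF clinear_eps_t])

text \<open>\<open>E (a \<otimes> b) = \<Sum> a\<^sub>(\<^sub>1\<^sub>) \<otimes> \<epsilon>\<^sub>t(a\<^sub>(\<^sub>2\<^sub>)) b\<close>, covered by \<open>c\<close>.\<close>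

lemma E_eps_t:
  "(mult_of c \<boxtimes> 1) \<rhd> E \<rhd> (a \<otimes> b) = tensor_map (\<lambda>x. x) (\<lambda>q. eps_t \<Delta> S q \<rhd> b) (T2 \<Delta> (c \<otimes> a))"
proof (rule tensor_cancel_second(1)[OF nondegenerate])
  fix d
  have "(1 \<boxtimes> mult_of d) \<rhd> (mult_of c \<boxtimes> 1) \<rhd> E \<rhd> (a \<otimes> b) =
      tensor_map (\<lambda>x. x) (\<lambda>q. mult_eps_t \<Delta> S d q * b) (T2 \<Delta> (c \<otimes> a))"
    by (simp only: pure_tensor_mult[symmetric] S_E_left tensor_map_def)
  also have "\<dots> = (1 \<boxtimes> mult_of d) \<rhd> tensor_map (\<lambda>x. x) (\<lambda>q. eps_t \<Delta> S q \<rhd> b) (T2 \<Delta> (c \<otimes> a))"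
    by (simp add: mult_tensor_apply tensor_map_comp clinear_id clinear_eps_t_apply clinear_mult_left
        multiplier_module(3) mult_right_eps_t)
  finally show "(1 \<boxtimes> mult_of d) \<rhd> (mult_of c \<boxtimes> 1) \<rhd> E \<rhd> (a \<otimes> b) =
    (1 \<boxtimes> mult_of d) \<rhd> tensor_map (\<lambda>x. x) (\<lambda>q. eps_t \<Delta> S q \<rhd> b) (T2 \<Delta> (c \<otimes> a))" .
qed

text \<open>\<open>(1 \<otimes> b) E (r \<otimes> s) = \<Sum> \<epsilon>\<^sub>s(b\<^sub>(\<^sub>1\<^sub>)) r \<otimes> b\<^sub>(\<^sub>2\<^sub>) s\<close>.\<close>

lemma E_eps_s:
  "(1 \<boxtimes> mult_of b) \<rhd> E \<rhd> (r \<otimes> s) = tensor_map (\<lambda>p. eps_s_mult \<Delta> S p r) (\<lambda>x. x) (T1 \<Delta> (b \<otimes> s))"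
proof (rule tensor_cancel_first(1)[OF nondegenerate])
  fix c
  have "(mult_of c \<boxtimes> 1) \<rhd> (1 \<boxtimes> mult_of b) \<rhd> E \<rhd> (r \<otimes> s) = (c \<otimes> b) * (E \<rhd> (r \<otimes> s))"
    using mult_left_simps(7)[of "mult_of c \<boxtimes> 1" "1 \<boxtimes> mult_of b"]
    by (simp add: mult_tensor_times mult_of_pure_tensor[symmetric] del: mult_left_simps(7))
  also have "\<dots> = tensor_map (\<lambda>p. c * eps_s_mult \<Delta> S p r) (\<lambda>x. x) (T1 \<Delta> (b \<otimes> s))"
    by (simp only: multiplier_module(3) S_E_right tensor_map_def)
  also have "\<dots> = (mult_of c \<boxtimes> 1) \<rhd> tensor_map (\<lambda>p. eps_s_mult \<Delta> S p r) (\<lambda>x. x) (T1 \<Delta> (b \<otimes> s))"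
    by (simp add: mult_tensor_apply tensor_map_comp clinear_id clinear_eps_s_mult clinear_mult_left)
  finally show "(mult_of c \<boxtimes> 1) \<rhd> (1 \<boxtimes> mult_of b) \<rhd> E \<rhd> (r \<otimes> s) =
    (mult_of c \<boxtimes> 1) \<rhd> tensor_map (\<lambda>p. eps_s_mult \<Delta> S p r) (\<lambda>x. x) (T1 \<Delta> (b \<otimes> s))" .
qed

lemma clinear_eps_t_first: "clinear (\<lambda>q. (eps_t \<Delta> S q \<boxtimes> 1) \<rhd> w)"
  by (rule clinearI) (simp_all add: clinearD[OF clinear_eps_t] mult_tensor_linear)

lemma leg12_E_eps_t:
  "(mult_of c \<boxtimes> 1) \<rhd> leg12 E \<rhd> (a \<otimes> w) =
    tensor_map (\<lambda>x. x) (\<lambda>q. (eps_t \<Delta> S q \<boxtimes> 1) \<rhd> w) (T2 \<Delta> (c \<otimes> a))"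
proof (induction w rule: tensor_induct)
  case (pure s t)
  have "(mult_of c \<boxtimes> 1) \<rhd> leg12 E \<rhd> (a \<otimes> s \<otimes> t) = tensor_assoc (((mult_of c \<boxtimes> 1) \<rhd> E \<rhd> (a \<otimes> s)) \<otimes> t)"
    by (simp add: leg12_pure_left tensor_assoc_mult_first)
  also have "\<dots> = tensor_map (\<lambda>x. x) (\<lambda>q. (eps_t \<Delta> S q \<rhd> s) \<otimes> t) (T2 \<Delta> (c \<otimes> a))"
    by (simp add: E_eps_t tensor_assoc_map_second clinear_eps_t_apply)
  finally show ?case by simp
next
  case (add x y)
  then show ?case
    by (simp add: tensor_add_right clinearD[OF clinear_mult_left']
        tensor_map_linear(2)[OF clinear_id clinear_id clinear_eps_t_first clinear_eps_t_first])
qed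

section \<open>The coproduct on products \<open>eps_t \<Delta> S q \<rhd> y\<close>\<close>

lemma id_Delta: "clinear (id_Delta \<Delta>)" "id_Delta \<Delta> (p \<otimes> q) = mult_of p \<boxtimes> \<Delta> q"
proof -
  have "cbilinear (\<lambda>p q. mult_of (p :: 'a) \<boxtimes> \<Delta> q)"
    by (rule cbilinearI) (simp_all add: mult_of_hom mult_tensor_linear clinearD[OF Delta_linear])
  from tensor_lift[OF this] show "clinear (id_Delta \<Delta>)" "id_Delta \<Delta> (p \<otimes> q) = mult_of p \<boxtimes> \<Delta> q"
    unfolding id_Delta_def by auto
qed

lemma Delta_apply_linear: "clinear (\<lambda>q. \<Delta> q \<rhd> w)"
  by (rule clinearI) (simp_all add: clinearD[OF Delta_linear])

lemma id_Delta_apply: "id_Delta \<Delta> z \<rhd> (r \<otimes> w) = tensor_map (\<lambda>p. p * r) (\<lambda>q. \<Delta> q \<rhd> w) z"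
proof (rule tensor_ext[of "\<lambda>z. id_Delta \<Delta> z \<rhd> (r \<otimes> w)"])
  note m = tensor_map[OF clinear_mult_right Delta_apply_linear]
  show "clinear (\<lambda>z. id_Delta \<Delta> z \<rhd> (r \<otimes> w))"
    by (rule clinearI) (simp_all add: clinearD[OF id_Delta(1)])
  show "clinear (tensor_map (\<lambda>p. p * r) (\<lambda>q. \<Delta> q \<rhd> w))"
    by (rule m)
  show "id_Delta \<Delta> (a \<otimes> b) \<rhd> (r \<otimes> w) = tensor_map (\<lambda>p. p * r) (\<lambda>q. \<Delta> q \<rhd> w) (a \<otimes> b)" for a b
    by (simp add: id_Delta m)
qed

lemma id_Delta_mult_first: "id_Delta \<Delta> ((mult_of c \<boxtimes> 1) \<rhd> z) = (mult_of c \<boxtimes> 1) * id_Delta \<Delta> z"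
  by (induction z rule: tensor_induct)
    (simp_all add: id_Delta clinearD[OF id_Delta(1)] mult_of_hom mult_tensor_times
      clinearD[OF clinear_mult_left'] distrib_left)

text \<open>The axiom \<open>(id \<otimes> \<Delta>)E = (E \<otimes> 1)(1 \<otimes> E)\<close> in
  covered form: multiplicativity of the extension splits off \<open>a \<otimes> \<Delta>(y)\<close>,
  and the factor \<open>1 \<otimes> E\<close> is absorbed by \<open>\<Delta>(y)\<close>.\<close>

lemma id_Delta_E_apply:
  "id_Delta \<Delta> (E \<rhd> (a \<otimes> y)) \<rhd> (r \<otimes> w) = leg12 E \<rhd> ((a * r) \<otimes> (\<Delta> y \<rhd> w))"
proof -
  obtain \<Phi> where \<Phi>: "multiplier_extension (id_Delta \<Delta>) (1 \<boxtimes> E) \<Phi>" "\<Phi> E = leg12 E * (1 \<boxtimes> E)"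
    using id_Delta_E by blast
  then have "id_Delta \<Delta> (E \<rhd> (a \<otimes> y)) = \<Phi> (mult_of (E \<rhd> (a \<otimes> y)))"
    by (simp add: multiplier_extension_def)
  also have "\<dots> = \<Phi> E * \<Phi> (mult_of (a \<otimes> y))"
    using \<Phi>(1) by (simp add: multiplier_extension_def mult_of_hom)
  also have "\<dots> = leg12 E * (1 \<boxtimes> E) * (mult_of a \<boxtimes> \<Delta> y)"
    using \<Phi> by (simp add: multiplier_extension_def id_Delta)
  finally show ?thesis by (simp add: E_Delta)
qed

text \<open>This is \<open>\<Delta>(\<epsilon>\<^sub>t(q)) = (\<epsilon>\<^sub>t(q) \<otimes> 1) E\<close>, without the extension of \<open>\<Delta>\<close> to multipliers.\<close>

lemma Delta_eps_t: "\<Delta> (eps_t \<Delta> S q \<rhd> y) \<rhd> w = (eps_t \<Delta> S q \<boxtimes> 1) \<rhd> \<Delta> y \<rhd> w"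
proof -
  let ?G = "\<lambda>q. \<Delta> (eps_t \<Delta> S q \<rhd> y) \<rhd> w" and ?H = "\<lambda>q. (eps_t \<Delta> S q \<boxtimes> 1) \<rhd> \<Delta> y \<rhd> w"
  have G: "clinear ?G" by (rule clinear_comp[OF Delta_apply_linear clinear_eps_t_apply])
  have H: "clinear ?H" by (rule clinear_eps_t_first)
  \<comment> \<open>Both sides are evaluations of
    \<open>(c \<otimes> 1)(E \<otimes> 1)(a \<otimes> \<Delta>(y)w)\<close>: for \<open>?G\<close>
    one applies \<open>id \<otimes> \<Delta>\<close> to
    \<open>(c \<otimes> 1)E(a \<otimes> y)\<close>, for \<open>?H\<close> one expands
    \<open>E\<close> in the first two legs. The factor \<open>r\<close> only covers the first
    leg.\<close>
  have eq: "tensor_map (\<lambda>x. x) ?G (T2 \<Delta> (c \<otimes> a)) = tensor_map (\<lambda>x. x) ?H (T2 \<Delta> (c \<otimes> a))" for c a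
  proof (rule tensor_cancel_first(2)[OF nondegenerate])
    fix r
    have "tensor_map (\<lambda>x. x) ?G (T2 \<Delta> (c \<otimes> a)) \<lhd> (mult_of r \<boxtimes> 1) =
        tensor_map (\<lambda>p. p * r) (\<lambda>v. \<Delta> v \<rhd> w) (tensor_map (\<lambda>x. x) (\<lambda>q. eps_t \<Delta> S q \<rhd> y) (T2 \<Delta> (c \<otimes> a)))"
      by (simp add: mult_tensor_apply tensor_map_comp clinear_id clinear_mult_right Delta_apply_linear
          G clinear_eps_t_apply)
    also have "\<dots> = (mult_of c \<boxtimes> 1) \<rhd> leg12 E \<rhd> ((a \<otimes> (\<Delta> y \<rhd> w)) \<lhd> (mult_of r \<boxtimes> 1))"
      by (simp add: E_eps_t[symmetric] id_Delta_apply[symmetric] id_Delta_mult_first id_Delta_E_apply)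
    also have "\<dots> = ((mult_of c \<boxtimes> 1) \<rhd> leg12 E \<rhd> (a \<otimes> (\<Delta> y \<rhd> w))) \<lhd> (mult_of r \<boxtimes> 1)"
      by (simp only: multiplier_assoc[OF nondegenerate_tensor[OF nondegenerate nondegenerate2]])
    finally show "tensor_map (\<lambda>x. x) ?G (T2 \<Delta> (c \<otimes> a)) \<lhd> (mult_of r \<boxtimes> 1) =
        tensor_map (\<lambda>x. x) ?H (T2 \<Delta> (c \<otimes> a)) \<lhd> (mult_of r \<boxtimes> 1)"
      by (simp only: leg12_E_eps_t)
  qed
  \<comment> \<open>Slicing \<open>eq\<close> gives the claim on second legs of \<open>T2\<close>,
    hence everywhere by fullness.\<close>
  have "q \<in> {q. ?G q = ?H q}"
  proof (rule right_leg_slices)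
    show "cvec.subspace {q. ?G q = ?H q}"
      by (rule cvec.subspaceI) (simp_all only: mem_Collect_eq clinearD[OF G] clinearD[OF H])
    show "left_slice f (T2 \<Delta> (c \<otimes> a)) \<in> {q. ?G q = ?H q}" if f: "clinear f" for f c a
      using arg_cong[OF eq[of c a], of "left_slice f"]
      by (simp add: left_slice_tensor_map[OF f clinear_id G] left_slice_tensor_map[OF f clinear_id H])
  qed
  then show ?thesis by simp
qed

section \<open>Coassociativity and the basic relation for cointegrals\<close>

text \<open>The map \<open>r \<otimes> t \<mapsto> \<Sum> a\<^sub>(\<^sub>1\<^sub>) \<otimes> a\<^sub>(\<^sub>2\<^sub>) r \<otimes> a\<^sub>(\<^sub>3\<^sub>) t\<close>.\<close>

definition Delta2_mult :: "'a \<Rightarrow> 'a \<otimes> 'a \<Rightarrow> 'a \<otimes> 'a \<otimes> 'a" where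
  "Delta2_mult a = tensor_lift (\<lambda>r t. tensor_assoc (tensor_map (\<lambda>u. T1 \<Delta> (u \<otimes> r)) (\<lambda>v. v) (T1 \<Delta> (a \<otimes> t))))"

lemma clinear_T1_first: "clinear (\<lambda>u. T1 \<Delta> (u \<otimes> r))"
  by (rule clinearI) (simp_all add: tensor_add_left tensor_scaleC_left clinearD[OF T1_linear])

lemma Delta2_mult:
  "clinear (Delta2_mult a)"
  "Delta2_mult a (r \<otimes> t) = tensor_assoc (tensor_map (\<lambda>u. T1 \<Delta> (u \<otimes> r)) (\<lambda>v. v) (T1 \<Delta> (a \<otimes> t)))"
proof -
  note m = tensor_map[OF clinear_T1_first clinear_id]
  have "cbilinear (\<lambda>r t. tensor_assoc (tensor_map (\<lambda>u. T1 \<Delta> (u \<otimes> r)) (\<lambda>v. v) (T1 \<Delta> (a \<otimes> t))))"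
    by (rule cbilinearI)
      (simp_all add: clinearD[OF tensor_assoc(1)] clinearD[OF T1_linear] clinearD[OF m(1)]
        tensor_add_right tensor_scaleC_right
        tensor_map_linear[OF clinear_T1_first clinear_T1_first clinear_id clinear_id])
  from tensor_lift[OF this] show "clinear (Delta2_mult a)"
    "Delta2_mult a (r \<otimes> t) = tensor_assoc (tensor_map (\<lambda>u. T1 \<Delta> (u \<otimes> r)) (\<lambda>v. v) (T1 \<Delta> (a \<otimes> t)))"
    unfolding Delta2_mult_def by auto
qed

lemma Delta_id_apply:
  "Delta_id \<Delta> z \<rhd> (p \<otimes> q \<otimes> s) = tensor_assoc (tensor_map (\<lambda>u. \<Delta> u \<rhd> (p \<otimes> q)) (\<lambda>v. v * s) z)"
proof (rule tensor_ext[of "\<lambda>z. Delta_id \<Delta> z \<rhd> (p \<otimes> q \<otimes> s)"])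
  have leg12_linear: "leg12 (x + y) = leg12 x + leg12 y" "leg12 (c *\<^sub>C x) = c *\<^sub>C leg12 x" for x y and c
    by (rule multiplier_tensor3_eqI;
        simp add: leg12_def mult_assoc_apply mult_tensor_linear clinearD[OF tensor_assoc(1)])+
  have "cbilinear (\<lambda>p q. leg12 (\<Delta> p) * (1 \<boxtimes> 1 \<boxtimes> mult_of q))"
    by (rule cbilinearI)
      (simp_all add: mult_of_hom mult_tensor_linear clinearD[OF Delta_linear] leg12_linear
        distrib_left distrib_right)
  note l = tensor_lift[OF this, folded Delta_id_def]
  show "clinear (\<lambda>z. Delta_id \<Delta> z \<rhd> (p \<otimes> q \<otimes> s))"
    by (rule clinearI) (simp_all add: clinearD[OF l(1)])
  show "clinear (\<lambda>z. tensor_assoc (tensor_map (\<lambda>u. \<Delta> u \<rhd> (p \<otimes> q)) (\<lambda>v. v * s) z))"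
    by (rule clinear_comp[OF tensor_assoc(1) tensor_map(1)[OF Delta_apply_linear clinear_mult_right]])
  show "Delta_id \<Delta> (a \<otimes> b) \<rhd> (p \<otimes> q \<otimes> s) =
      tensor_assoc (tensor_map (\<lambda>u. \<Delta> u \<rhd> (p \<otimes> q)) (\<lambda>v. v * s) (a \<otimes> b))" for a b
    by (simp add: l tensor_map[OF Delta_apply_linear clinear_mult_right] leg12_pure_left)
qed

text \<open>Coassociativity: \<open>Delta2_mult\<close> splits the first leg of
  \<open>\<Delta>(a)\<close>, the right-hand side splits the second. Multiplying by
  \<open>p \<otimes> q \<otimes> s\<close> on the right brings both into the shape of the
  axiom.\<close>

lemma Delta2_mult_left:
  "(mult_of c \<boxtimes> 1) \<rhd> Delta2_mult a z = tensor_map (\<lambda>x. x) (\<lambda>v. \<Delta> v \<rhd> z) (T2 \<Delta> (c \<otimes> a))"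
proof (induction z rule: tensor_induct)
  case (pure r t)
  show ?case
  proof (rule tensor3_mult_cancel[OF nondegenerate nondegenerate nondegenerate])
    fix p q s
    note m = tensor_map[OF clinear_T1_first clinear_id]
      and D = tensor_map[OF Delta_apply_linear clinear_mult_right]
    have *: "tensor_assoc (tensor_map (\<lambda>u. T1 \<Delta> (u \<otimes> r)) (\<lambda>v. v) z) * (p \<otimes> q \<otimes> s) =
        tensor_assoc (tensor_map (\<lambda>u. \<Delta> u \<rhd> (p \<otimes> (r * q))) (\<lambda>v. v * s) z)" for z :: "'a \<otimes> 'a"
    proof (induction z rule: tensor_induct)
      case (pure u v)
      have "tensor_assoc (T1 \<Delta> (u \<otimes> r) \<otimes> v) * tensor_assoc ((p \<otimes> q) \<otimes> s) =
          tensor_assoc ((\<Delta> u \<rhd> (p \<otimes> (r * q))) \<otimes> (v * s))"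
        by (simp only: tensor_assoc_mult[symmetric] times_pure_tensor T1_times) simp
      then show ?case by (simp add: m D tensor_assoc)
    qed (simp add: clinearD[OF m(1)] clinearD[OF D(1)] clinearD[OF tensor_assoc(1)] distrib_right)
    have "((mult_of c \<boxtimes> 1) \<rhd> Delta2_mult a (r \<otimes> t)) * (p \<otimes> q \<otimes> s) =
        (mult_of c \<boxtimes> 1 \<boxtimes> 1) \<rhd> Delta_id \<Delta> (T1 \<Delta> (a \<otimes> t)) \<rhd> (p \<otimes> (r * q) \<otimes> s)"
      by (simp only: Delta2_mult multiplier_module(1)[symmetric] * Delta_id_apply one_mult_tensor)
    also have "\<dots> = id_Delta \<Delta> (T2 \<Delta> (c \<otimes> a)) \<rhd> (p \<otimes> (r * q) \<otimes> (t * s))"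
      using arg_cong[OF coassociative, of "\<lambda>m. m \<rhd> (p \<otimes> (r * q) \<otimes> s)"] by simp
    also have "\<dots> = tensor_map (\<lambda>x. x) (\<lambda>v. \<Delta> v \<rhd> (r \<otimes> t)) (T2 \<Delta> (c \<otimes> a)) * (p \<otimes> q \<otimes> s)"
    proof -
      note D' = tensor_map[OF clinear_mult_right Delta_apply_linear]
        and i = tensor_map[OF clinear_id Delta_apply_linear]
      have "tensor_map (\<lambda>x. x * p) (\<lambda>v. \<Delta> v \<rhd> ((r * q) \<otimes> (t * s))) z =
        tensor_map (\<lambda>x. x) (\<lambda>v. \<Delta> v \<rhd> (r \<otimes> t)) z * (p \<otimes> q \<otimes> s)" for z :: "'a \<otimes> 'a"
        by (induction z rule: tensor_induct)
          (simp_all add: D' i clinearD[OF D'(1)] clinearD[OF i(1)] times_pure_tensor distrib_right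
            multiplier_module(1)[symmetric])
      then show ?thesis by (simp add: id_Delta_apply)
    qed
    finally show "((mult_of c \<boxtimes> 1) \<rhd> Delta2_mult a (r \<otimes> t)) * (p \<otimes> q \<otimes> s) =
      tensor_map (\<lambda>x. x) (\<lambda>v. \<Delta> v \<rhd> (r \<otimes> t)) (T2 \<Delta> (c \<otimes> a)) * (p \<otimes> q \<otimes> s)" .
  qed
next
  case (add x y)
  then show ?case
    by (simp add: clinearD[OF Delta2_mult(1)] clinearD[OF clinear_mult_left']
        tensor_map_linear(2)[OF clinear_id clinear_id Delta_apply_linear Delta_apply_linear])
qed

text \<open>The sum of \<open>S(a1) a2 h1 \<otimes> a3 h2\<close>, in Sweedler legs of
  \<open>a\<close> and \<open>h\<close>, is computed in two ways. Grouping \<open>S(a1) a2\<close>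
  gives \<open>(1 \<otimes> a)E\<Delta>(h)\<close>. Using \<open>\<Delta>(a2 h) =
  (\<epsilon>\<^sub>t(a2) \<otimes> 1)\<Delta>(h)\<close> first gives the legs of
  \<open>E(a \<otimes> h1)\<close> with \<open>S\<close> applied to the first, that is,
  \<open>(S(a) \<otimes> 1)\<Delta>(h)\<close>.\<close>

lemma cointegral_Delta_times:
  assumes h: "\<And>a. a * h = eps_t \<Delta> S a \<rhd> h"
  shows "(1 \<boxtimes> mult_of a) * \<Delta> h = (S a \<boxtimes> 1) * \<Delta> h"
proof (rule multiplier_eq_leftI[OF nondegenerate2])
  fix w
  define z where "z = \<Delta> h \<rhd> w"
  define mS where "mS = tensor_lift (\<lambda>p q. S p \<rhd> q)"
  \<comment> \<open>\<open>\<Theta>\<close> sends \<open>p \<otimes> q \<otimes> t\<close> to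
    \<open>(S p \<rhd> q) \<otimes> t\<close>.\<close>
  define \<Theta> where "\<Theta> x = tensor_map mS (\<lambda>t. t) (tensor_assoc_inv x)" for x :: "'a \<otimes> 'a \<otimes> 'a"
  have mS: "clinear mS" unfolding mS_def by (rule tensor_lift(1)[OF cbilinear_S_mult])
  note m = tensor_map[OF mS clinear_id]
  have \<Theta>: "clinear \<Theta>" unfolding \<Theta>_def by (rule clinear_comp[OF m(1) tensor_assoc(3)])
  have "Delta2_mult a z = leg12 E \<rhd> (a \<otimes> z)"
  proof (rule tensor_cancel_first(1)[OF nondegenerate])
    fix c
    \<comment> \<open>The cointegral property enters here: \<open>v * h\<close> is replaced by
      \<open>eps_t \<Delta> S v \<rhd> h\<close> under \<open>\<Delta>\<close>.\<close>
    have "\<Delta> v \<rhd> z = (eps_t \<Delta> S v \<boxtimes> 1) \<rhd> z" for v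
      unfolding z_def Delta_eps_t[symmetric] h[symmetric] by (simp add: Delta_mult)
    then show "(mult_of c \<boxtimes> 1) \<rhd> Delta2_mult a z = (mult_of c \<boxtimes> 1) \<rhd> leg12 E \<rhd> (a \<otimes> z)"
      by (simp add: Delta2_mult_left leg12_E_eps_t)
  qed
  moreover have "\<Theta> (Delta2_mult a x) = (1 \<boxtimes> mult_of a) \<rhd> E \<rhd> x" for x
  proof (rule tensor_ext[of "\<lambda>x. \<Theta> (Delta2_mult a x)" "\<lambda>x. (1 \<boxtimes> mult_of a) \<rhd> E \<rhd> x"])
    show "clinear (\<lambda>x. \<Theta> (Delta2_mult a x))" by (rule clinear_comp[OF \<Theta> Delta2_mult(1)])
    show "clinear (\<lambda>x. (1 \<boxtimes> mult_of a) \<rhd> E \<rhd> x)" by (rule clinear_comp[OF clinear_mult_left' clinear_mult_left'])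
    show "\<Theta> (Delta2_mult a (r \<otimes> t)) = (1 \<boxtimes> mult_of a) \<rhd> E \<rhd> (r \<otimes> t)" for r t
      by (simp add: \<Theta>_def Delta2_mult tensor_map_comp[OF mS clinear_id clinear_T1_first clinear_id]
          E_eps_s eps_s_mult_def mS_def[symmetric])
  qed
  moreover have "\<Theta> (leg12 E \<rhd> (a \<otimes> x)) = (S a \<boxtimes> 1) \<rhd> x" for x
  proof (rule tensor_ext[of "\<lambda>x. \<Theta> (leg12 E \<rhd> (a \<otimes> x))" "\<lambda>x. (S a \<boxtimes> 1) \<rhd> x"])
    show "clinear (\<lambda>x. \<Theta> (leg12 E \<rhd> (a \<otimes> x)))"
      by (rule clinear_comp[OF \<Theta>])
        (simp add: clinear_iff tensor_add_right tensor_scaleC_right clinearD[OF clinear_mult_left'])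
    show "clinear (\<lambda>x. (S a \<boxtimes> 1) \<rhd> x)" by (rule clinear_mult_left')
    show "\<Theta> (leg12 E \<rhd> (a \<otimes> r \<otimes> t)) = (S a \<boxtimes> 1) \<rhd> (r \<otimes> t)" for r t
      by (simp add: \<Theta>_def leg12_pure_left m) (simp add: mS_def S_id_S_left)
  qed
  ultimately have "(1 \<boxtimes> mult_of a) \<rhd> E \<rhd> z = (S a \<boxtimes> 1) \<rhd> z" by metis
  then show "((1 \<boxtimes> mult_of a) * \<Delta> h) \<rhd> w = ((S a \<boxtimes> 1) * \<Delta> h) \<rhd> w"
    by (simp add: z_def E_Delta)
qed

end

section \<open>Local units and annihilators\<close>

context regular_weak_multiplier_Hopf_algebra
begin

text \<open>By regularity \<open>S\<close> takes its values in \<open>A\<close>; this is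
  \<open>S\<close> read as a map from \<open>A\<close> to itself.\<close>

definition antip :: "'a \<Rightarrow> 'a" where "antip a = as_element (S a)"

lemma mult_of_antip: "mult_of (antip a) = S a"
  unfolding antip_def using regular by (intro mult_of_as_element) (auto simp: bij_betw_def)

lemma mult_of_eq_iff: "mult_of a = mult_of b \<longleftrightarrow> a = (b :: 'a)"
  using inj_mult_of[OF nondegenerate] by (simp add: inj_eq)

lemma antip_linear: "clinear antip"
  by (rule clinearI; simp add: mult_of_eq_iff[symmetric] mult_of_hom mult_of_antip clinearD[OF S_linear])

lemma antip_mult: "antip (a * b) = antip b * antip a"
  by (simp add: mult_of_eq_iff[symmetric] mult_of_hom(3) mult_of_antip S_antimult)

lemma bij_antip: "bij antip"
proof (rule bijI)
  show "inj antip"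
  proof (rule injI)
    fix a b assume "antip a = antip b"
    then have "S a = S b" by (simp only: mult_of_antip[symmetric])
    then show "a = b" using regular by (simp add: bij_betw_def inj_eq)
  qed
  show "surj antip"
    unfolding surj_def
  proof
    fix y
    have "mult_of y \<in> range S" using regular by (simp add: bij_betw_def)
    then obtain x where "mult_of y = S x" by blast
    then show "\<exists>x. y = antip x" by (auto simp: mult_of_eq_iff mult_of_antip[symmetric])
  qed
qed

lemma antip_surj: obtains y where "x = antip y"
  using bij_is_surj[OF bij_antip] unfolding surj_def by blast

lemma antip_eq_iff: "antip x = antip y \<longleftrightarrow> x = y"
  using bij_antip by (simp add: bij_is_inj inj_eq)

lemma S_apply: "S a \<rhd> b = antip a * b"
  by (simp add: mult_of_antip[symmetric])

lemma S_mult_lift: "tensor_lift (\<lambda>p q. S p \<rhd> q) (a \<otimes> b) = antip a * b"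
  by (subst tensor_lift(2)[OF cbilinear_S_mult]) (rule S_apply)

section \<open>Local units from finite-dimensional left multiples\<close>

lemma subspace_left_multiples: "cvec.subspace {a * x |a. True}" for x :: 'a
proof (rule cvec.subspaceI)
  show "0 \<in> {a * x |a. True}" by (auto intro!: exI[of _ 0])
  show "u + v \<in> {a * x |a. True}" if "u \<in> {a * x |a. True}" "v \<in> {a * x |a. True}" for u v
    using that by (auto simp: distrib_right[symmetric])
  show "c *\<^sub>C u \<in> {a * x |a. True}" if "u \<in> {a * x |a. True}" for c u
    using that by (auto simp: mult_scaleC_left[symmetric] simp del: mult_scaleC_left)
qed

text \<open>The second legs of \<open>\<Delta>(u)(1 \<otimes> x)\<close> lie in \<open>A x\<close>:
  multiplied by \<open>d \<otimes> 1\<close> on the left, this becomes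
  \<open>T2 \<Delta> (d \<otimes> u)\<close> times \<open>1 \<otimes> x\<close>. Multiplying such
  legs by \<open>S\<close> of the first ones stays in \<open>A x\<close>.\<close>

lemma eps_s_mult_left_multiple: "eps_s_mult \<Delta> S u x \<in> {a * x |a. True}"
proof -
  let ?W = "{a * x |a. True}"
  have "T1 \<Delta> (u \<otimes> x) \<in> tensor_subspace UNIV ?W"
  proof (rule mem_tensor_subspace_right_annihilator[OF subspace_left_multiples])
    fix f :: "'a \<Rightarrow> complex"
    assume f: "clinear f" "\<And>w. w \<in> ?W \<Longrightarrow> f w = 0"
    show "right_slice f (T1 \<Delta> (u \<otimes> x)) = 0"
    proof (rule nondegenerate_cancel(1)[OF nondegenerate])
      fix d
      have "d * right_slice f (T1 \<Delta> (u \<otimes> x)) = right_slice f ((mult_of d \<boxtimes> 1) \<rhd> T1 \<Delta> (u \<otimes> x))"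
        by (simp add: right_slice_mult_tensor f(1))
      also have "\<dots> = right_slice (\<lambda>v. f (v * x)) (T2 \<Delta> (d \<otimes> u))"
        by (simp add: mult_T1_eq_T2_mult right_slice_mult_tensor f(1))
      also have "(\<lambda>v. f (v * x)) = (\<lambda>_. 0)" using f(2) by blast
      finally show "d * right_slice f (T1 \<Delta> (u \<otimes> x)) = d * 0"
        by simp
    qed
  qed
  then show ?thesis
    unfolding tensor_subspace_def eps_s_mult_def
  proof (induction rule: cvec.span_induct_alt)
    case base
    then show ?case
      by (simp add: clinearD[OF tensor_lift(1)[OF cbilinear_S_mult]]
          cvec.subspace_0[OF subspace_left_multiples, simplified])
  next
    case (step c p z)
    then obtain v a where "p = v \<otimes> (a * x)" by auto
    then have "tensor_lift (\<lambda>p q. S p \<rhd> q) p = (antip v * a) * x"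
      by (simp only: S_mult_lift mult.assoc)
    then have "tensor_lift (\<lambda>p q. S p \<rhd> q) p \<in> ?W" by blast
    then show ?case
      using step.IH
      by (simp only: clinearD[OF tensor_lift(1)[OF cbilinear_S_mult]]
          cvec.subspace_add[OF subspace_left_multiples] cvec.subspace_scale[OF subspace_left_multiples])
  qed
qed

text \<open>
  \<open>E (x \<otimes> d)\<close> lies in \<open>A x \<otimes> A\<close>. If \<open>A x\<close> is finite-dimensional, its coordinates on \<open>A x\<close> are of the
  form \<open>\<epsilon>\<^sub>t(q) d\<close> with \<open>q\<close> independent of \<open>d\<close>, and \<open>\<Sum> S(E\<^sub>1 x) E\<^sub>2 d = S(x) d\<close> gives a unit for \<open>S(x)\<close>.
\<close>

lemma left_unit_of_finite_dim:
  fixes x :: 'a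
  assumes Y: "finite Y" "{a * x |a. True} \<subseteq> cvec.span Y"
  shows "\<exists>t. x = t * x"
proof -
  let ?W = "{a * x |a. True}"
  \<comment> \<open>\<open>F\<close> collects the functionals whose slice of
    \<open>E(x \<otimes> d)\<close> has the form \<open>\<epsilon>\<^sub>t(q) d\<close> with one
    \<open>q\<close> for all \<open>d\<close>. Coordinates on \<open>A x\<close> are taken from
    \<open>F\<close> so that the unit built from them does not depend on \<open>d\<close>.\<close>
  define F where "F = {f :: 'a \<Rightarrow> complex. clinear f \<and>
    (\<exists>q. \<forall>d. left_slice f (E \<rhd> (x \<otimes> d)) = eps_t \<Delta> S q \<rhd> d)}"
  \<comment> \<open>After covering the second leg by \<open>e\<close>, the first legs are
    \<open>\<epsilon>\<^sub>s(p) x\<close>, which lie in \<open>A x\<close> by the preceding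
    lemma.\<close>
  have mem: "E \<rhd> (x \<otimes> d) \<in> tensor_subspace ?W UNIV" for d
  proof (rule mem_tensor_subspace_left_annihilator[OF subspace_left_multiples])
    fix f :: "'a \<Rightarrow> complex"
    assume f: "clinear f" "\<And>w. w \<in> ?W \<Longrightarrow> f w = 0"
    show "left_slice f (E \<rhd> (x \<otimes> d)) = 0"
    proof (rule nondegenerate_cancel(1)[OF nondegenerate])
      fix e
      have "e * left_slice f (E \<rhd> (x \<otimes> d)) = left_slice f ((1 \<boxtimes> mult_of e) \<rhd> E \<rhd> (x \<otimes> d))"
        by (simp add: left_slice_mult_tensor f(1))
      also have "\<dots> = left_slice (\<lambda>p. f (eps_s_mult \<Delta> S p x)) (T1 \<Delta> (e \<otimes> d))"
        by (simp add: E_eps_s left_slice_tensor_map[OF f(1) clinear_eps_s_mult clinear_id])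
      also have "(\<lambda>p. f (eps_s_mult \<Delta> S p x)) = (\<lambda>_. 0)"
        using f(2) eps_s_mult_left_multiple by blast
      finally show "e * left_slice f (E \<rhd> (x \<otimes> d)) = e * 0"
        by simp
    qed
  qed
  have "\<exists>(n::nat) f y. (\<forall>i<n. f i \<in> F \<and> y i \<in> ?W) \<and> (\<forall>w\<in>?W. w = (\<Sum>i<n. f i w *\<^sub>C y i))"
  proof (rule separating_functionals_dual_basis[OF Y(1) subspace_left_multiples Y(2)])
    note l = clinearD[OF clinear_eps_t]
    show "clinear f" if "f \<in> F" for f using that by (simp add: F_def)
    show "(\<lambda>_. 0) \<in> F" by (auto simp: F_def clinear_iff l intro!: exI[of _ 0])
    show "(\<lambda>x. f x + g x) \<in> F" if fg: "f \<in> F" "g \<in> F" for f g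
    proof -
      from fg obtain q r where "\<And>d. left_slice f (E \<rhd> (x \<otimes> d)) = eps_t \<Delta> S q \<rhd> d"
        "\<And>d. left_slice g (E \<rhd> (x \<otimes> d)) = eps_t \<Delta> S r \<rhd> d" by (auto simp: F_def)
      moreover have "clinear f" "clinear g" using fg by (simp_all add: F_def)
      moreover from this have "clinear (\<lambda>x. f x + g x)" by (simp add: clinear_iff algebra_simps)
      ultimately show ?thesis by (auto simp: F_def left_slice_linear l intro!: exI[of _ "q + r"])
    qed
    show "(\<lambda>x. c * f x) \<in> F" if f: "f \<in> F" for f c
    proof -
      from f obtain q where "\<And>d. left_slice f (E \<rhd> (x \<otimes> d)) = eps_t \<Delta> S q \<rhd> d"
        by (auto simp: F_def)
      moreover have "clinear f" using f by (simp add: F_def)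
      moreover from this have "clinear (\<lambda>x. c * f x)" by (simp add: clinear_iff algebra_simps)
      ultimately show ?thesis by (auto simp: F_def left_slice_linear l intro!: exI[of _ "c *\<^sub>C q"])
    qed
    \<comment> \<open>\<open>F\<close> separates points because it contains every functional of the
      form \<open>\<lambda>a. g (c * a)\<close>, with \<open>q\<close> a slice of
      \<open>T2 \<Delta> (c \<otimes> x)\<close>; non-degeneracy then removes
      \<open>c\<close>.\<close>
    show "w = 0" if w: "\<And>f. f \<in> F \<Longrightarrow> f w = 0" for w
    proof (rule nondegenerate_cancel(1)[OF nondegenerate])
      fix c
      have "g (c * w) = 0" if g: "clinear g" for g :: "'a \<Rightarrow> complex"
      proof (rule w)
        have "left_slice (\<lambda>a. g (c * a)) (E \<rhd> (x \<otimes> d)) = eps_t \<Delta> S (left_slice g (T2 \<Delta> (c \<otimes> x))) \<rhd> d" for d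
        proof -
          have "left_slice (\<lambda>a. g (c * a)) (E \<rhd> (x \<otimes> d)) = left_slice g ((mult_of c \<boxtimes> 1) \<rhd> E \<rhd> (x \<otimes> d))"
            by (simp add: left_slice_mult_tensor g)
          then show ?thesis
            by (simp add: E_eps_t left_slice_tensor_map[OF g clinear_id clinear_eps_t_apply])
        qed
        moreover have "clinear (\<lambda>a. g (c * a))" by (rule clinear_comp[OF g clinear_mult_left])
        ultimately show "(\<lambda>a. g (c * a)) \<in> F" by (auto simp: F_def)
      qed
      then show "c * w = c * 0" using functionals_separate[of "c * w"] by simp
    qed
  qed
  then obtain n :: nat and f y where f: "\<And>i. i < n \<Longrightarrow> f i \<in> F" and y: "\<And>i. i < n \<Longrightarrow> y i \<in> ?W"
    and dual: "\<And>w. w \<in> ?W \<Longrightarrow> w = (\<Sum>i<n. f i w *\<^sub>C y i)" by blast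
  from f have "\<forall>i. \<exists>q. i < n \<longrightarrow> (\<forall>d. left_slice (f i) (E \<rhd> (x \<otimes> d)) = eps_t \<Delta> S q \<rhd> d)"
    by (auto simp: F_def)
  then obtain q where q: "\<And>i d. i < n \<Longrightarrow> left_slice (f i) (E \<rhd> (x \<otimes> d)) = eps_t \<Delta> S (q i) \<rhd> d"
    by metis
  from y have "\<forall>i. \<exists>v. i < n \<longrightarrow> y i = v * x" by blast
  then obtain v where v: "\<And>i. i < n \<Longrightarrow> y i = v i * x" by metis
  \<comment> \<open>The dual basis identity on \<open>A x\<close>, tensored with the identity of
    \<open>A\<close>.\<close>
  have expand: "z = (\<Sum>i<n. y i \<otimes> left_slice (f i) z)" if z: "z \<in> tensor_subspace ?W UNIV" for z :: "'a \<otimes> 'a"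
  proof -
    define R where "R z = (\<Sum>i<n. y i \<otimes> left_slice (f i) z)" for z :: "'a \<otimes> 'a"
    have lin: "clinear (f i)" if "i < n" for i using f[OF that] by (simp add: F_def)
    note s = left_slice[OF lin] clinearD[OF left_slice(1)[OF lin]]
    have R: "clinear R"
      by (rule clinearI)
        (simp_all add: R_def s tensor_add_right tensor_scaleC_right sum.distrib cvec.scale_sum_right)
    have "R (w \<otimes> b) = w \<otimes> b" if "w \<in> ?W" for w b
    proof -
      have "w \<otimes> b = (\<Sum>i<n. f i w *\<^sub>C y i) \<otimes> b" using dual[OF that] by simp
      also have "\<dots> = (\<Sum>i<n. (f i w *\<^sub>C y i) \<otimes> b)"
        by (rule clinear_sum[of "\<lambda>a. a \<otimes> b"]) (simp add: clinear_iff tensor_add_left tensor_scaleC_left)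
      also have "\<dots> = R (w \<otimes> b)" by (simp add: R_def s tensor_scaleC_left tensor_scaleC_right)
      finally show ?thesis by simp
    qed
    note pure = this
    from z have "R z = z"
      unfolding tensor_subspace_def
    proof (induction rule: cvec.span_induct_alt)
      case base
      show ?case by (rule clinearD(3)[OF R])
    next
      case (step c p z)
      then have "R p = p" using pure by blast
      then show ?case by (simp only: clinearD(1,2)[OF R] step.IH)
    qed
    then show ?thesis by (simp add: R_def)
  qed
  \<comment> \<open>Since \<open>y i = v i * x\<close> and \<open>antip\<close> reverses products,
    \<open>antip x\<close> factors out on the left of every summand of \<open>S(E1 x) E2 d\<close>;
    what remains is \<open>t\<close>.\<close>
  define t where "t = (\<Sum>i<n. antip (v i) \<lhd> eps_t \<Delta> S (q i))"
  have "antip x * d = antip x * t * d" for d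
  proof -
    let ?mS = "tensor_lift (\<lambda>p q. S p \<rhd> q)"
    have "antip x * d = ?mS (E \<rhd> (x \<otimes> d))" unfolding S_id_S_left by (rule S_apply[symmetric])
    also have "E \<rhd> (x \<otimes> d) = (\<Sum>i<n. y i \<otimes> (eps_t \<Delta> S (q i) \<rhd> d))"
      using expand[OF mem[of d]] by (simp add: q)
    also have "?mS \<dots> = (\<Sum>i<n. antip (y i) * (eps_t \<Delta> S (q i) \<rhd> d))"
      by (simp only: clinear_sum[OF tensor_lift(1)[OF cbilinear_S_mult]] S_mult_lift)
    also have "\<dots> = (\<Sum>i<n. antip x * (antip (v i) \<lhd> eps_t \<Delta> S (q i)) * d)"
      by (intro sum.cong) (simp_all add: v antip_mult multiplier_module mult.assoc)
    also have "\<dots> = antip x * t * d" by (simp add: t_def sum_distrib_left sum_distrib_right)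
    finally show ?thesis .
  qed
  then have "antip x = antip x * t" by (rule nondegenerate_cancel(2)[OF nondegenerate])
  \<comment> \<open>Pulling the right unit \<open>t\<close> of \<open>antip x\<close> back along the
    anti-automorphism gives a left unit of \<open>x\<close>.\<close>
  moreover obtain t' where "t = antip t'" by (rule antip_surj)
  ultimately show ?thesis by (metis antip_mult antip_eq_iff)
qed

section \<open>Consequences of a faithful cointegral\<close>

context
  fixes h
  assumes faithful: "faithful_left_cointegral \<Delta> S h"
begin

lemma mult_Delta_cointegral: "(1 \<boxtimes> mult_of a) * \<Delta> h = (S a \<boxtimes> 1) * \<Delta> h"
proof (rule cointegral_Delta_times)
  fix a
  have "mult_of (a * h) = mult_of (eps_t \<Delta> S a \<rhd> h)"
    using faithful by (simp add: faithful_left_cointegral_def left_cointegral_def mult_of_hom)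
  then show "a * h = eps_t \<Delta> S a \<rhd> h" by (simp add: mult_of_eq_iff)
qed

lemma mult_T1_cointegral:
  "(1 \<boxtimes> mult_of a) \<rhd> T1 \<Delta> (h \<otimes> b) = (mult_of (antip a) \<boxtimes> 1) \<rhd> T1 \<Delta> (h \<otimes> b)"
proof -
  have "mult_of ((1 \<boxtimes> mult_of a) \<rhd> T1 \<Delta> (h \<otimes> b)) = mult_of ((S a \<boxtimes> 1) \<rhd> T1 \<Delta> (h \<otimes> b))"
    by (simp only: mult_of_hom mult_of_T1 mult.assoc[symmetric] mult_Delta_cointegral)
  then show ?thesis using inj_mult_of[OF nondegenerate2] by (simp add: inj_eq mult_of_antip)
qed

text \<open>Faithfulness with only right-covered slices as hypothesis. As \<open>slice_id\<close>
  prescribes both actions of the multiplier, the left-covered slices must vanish too; the cointegral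
  relation deduces this from the right-covered ones.\<close>

lemma cointegral_slices_separate:
  assumes f: "clinear f" and zero: "\<And>b. left_slice f (T1 \<Delta> (h \<otimes> b)) = 0"
  shows "f a = 0"
proof -
  have 1: "as_element (\<Delta> h * (1 \<boxtimes> mult_of b)) = T1 \<Delta> (h \<otimes> b)" for b
    by (simp only: mult_of_T1[symmetric] as_element_mult_of[OF nondegenerate2])
  \<comment> \<open>The relation rewrites \<open>(1 \<otimes> b)\<Delta>(h)\<close> as
    \<open>(S(b) \<otimes> 1)\<Delta>(h)\<close>, which lies in \<open>A \<otimes> A\<close> as a
    value of \<open>T2\<close>.\<close>
  have 2: "as_element ((1 \<boxtimes> mult_of b) * \<Delta> h) = T2 \<Delta> (antip b \<otimes> h)" for b
    by (simp only: mult_Delta_cointegral mult_of_antip[symmetric] mult_of_T2[symmetric]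
        as_element_mult_of[OF nondegenerate2])
  have 3: "left_slice f (T2 \<Delta> (antip b \<otimes> h)) = 0" for b
  proof (rule nondegenerate_cancel(2)[OF nondegenerate])
    fix c
    have "left_slice f (T2 \<Delta> (antip b \<otimes> h)) * c = left_slice f (T2 \<Delta> (antip b \<otimes> h) \<lhd> (1 \<boxtimes> mult_of c))"
      by (simp add: left_slice_mult_tensor f)
    also have "\<dots> = left_slice f ((1 \<boxtimes> mult_of b) \<rhd> T1 \<Delta> (h \<otimes> c))"
      by (simp only: mult_T1_eq_T2_mult[symmetric] mult_T1_cointegral)
    also have "\<dots> = 0 * c" by (simp add: left_slice_mult_tensor f zero)
    finally show "left_slice f (T2 \<Delta> (antip b \<otimes> h)) * c = 0 * c" .
  qed
  have "slice_id f (\<Delta> h) = 0"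
    unfolding slice_id_def
  proof (rule the_equality)
    show "\<forall>b. 0 \<rhd> b = slice1 f (as_element (\<Delta> h * (1 \<boxtimes> mult_of b))) \<and>
        b \<lhd> 0 = slice1 f (as_element ((1 \<boxtimes> mult_of b) * \<Delta> h))"
      by (simp add: 1 2 3 zero slice1_eq_left_slice)
    show "m = 0" if "\<forall>b. m \<rhd> b = slice1 f (as_element (\<Delta> h * (1 \<boxtimes> mult_of b))) \<and>
        b \<lhd> m = slice1 f (as_element ((1 \<boxtimes> mult_of b) * \<Delta> h))" for m
      by (rule multiplier_eq_leftI[OF nondegenerate]) (use that in \<open>simp add: 1 zero slice1_eq_left_slice\<close>)
  qed
  then show ?thesis using faithful f by (simp add: faithful_left_cointegral_def)
qed

text \<open>The elements with finite-dimensional left multiples form a subspace \<open>?X\<close>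
  containing the right slices of all \<open>\<Delta>(h)(1 \<otimes> b)\<close>. A functional that
  vanishes on \<open>?X\<close> but not at \<open>x\<close> would therefore annihilate all left
  slices, against faithfulness.\<close>

lemma left_multiples_finite_dim: "\<exists>Y. finite Y \<and> {a * x |a. True} \<subseteq> cvec.span Y" for x :: 'a
proof (rule ccontr)
  let ?X = "{x :: 'a. \<exists>Y. finite Y \<and> (\<forall>a. a * x \<in> cvec.span Y)}"
  assume "\<not> (\<exists>Y. finite Y \<and> {a * x |a. True} \<subseteq> cvec.span Y)"
  then have x: "x \<notin> ?X" by blast
  have X: "cvec.subspace ?X"
  proof (rule cvec.subspaceI)
    show "0 \<in> ?X" by (auto simp: cvec.span_zero)
    show "u + v \<in> ?X" if uv: "u \<in> ?X" "v \<in> ?X" for u v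
    proof -
      from uv obtain Y Z where "finite Y" "finite Z" "\<And>a. a * u \<in> cvec.span Y" "\<And>a. a * v \<in> cvec.span Z"
        by blast
      moreover have "cvec.span Y \<subseteq> cvec.span (Y \<union> Z)" "cvec.span Z \<subseteq> cvec.span (Y \<union> Z)"
        by (simp_all add: cvec.span_mono)
      ultimately show ?thesis
        by (auto simp: distrib_left intro!: exI[of _ "Y \<union> Z"] cvec.span_add)
    qed
    show "c *\<^sub>C u \<in> ?X" if "u \<in> ?X" for c u
      using that by (auto intro: cvec.span_scale)
  qed
  obtain f :: "'a \<Rightarrow> complex"
    where f: "clinear f" "\<And>w. w \<in> ?X \<Longrightarrow> f w = 0" "f x \<noteq> 0"
    using functional_separates_subspace[OF X x] by blast
  have "left_slice f (T1 \<Delta> (h \<otimes> b)) = 0" for b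
  proof (rule functionals_separate)
    fix g :: "'a \<Rightarrow> complex"
    assume g: "clinear g"
    let ?z = "T1 \<Delta> (h \<otimes> b)"
    obtain K c where K: "finite K" "?z = (\<Sum>k\<in>K. c k *\<^sub>C (fst k \<otimes> snd k))" by (rule tensor_expand)
    \<comment> \<open>The first legs of one fixed finite expansion span all right slices, whatever
      the functional.\<close>
    have slice: "right_slice g' ?z \<in> cvec.span (fst ` K)" if g': "clinear g'" for g'
    proof -
      have "right_slice g' ?z = (\<Sum>k\<in>K. c k *\<^sub>C g' (snd k) *\<^sub>C fst k)"
        unfolding K by (simp only: clinear_sum[OF right_slice(1)[OF g']] right_slice(2)[OF g']
            clinearD[OF right_slice(1)[OF g']])
      also have "\<dots> \<in> cvec.span (fst ` K)"
        by (intro cvec.span_sum cvec.span_scale) (simp add: cvec.span_base)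
      finally show ?thesis .
    qed
    \<comment> \<open>Left multiplication of the first leg by \<open>a = antip a'\<close> moves to
      the second leg, where it only changes the functional.\<close>
    have "a * right_slice g ?z \<in> cvec.span (fst ` K)" for a
    proof -
      obtain a' where a: "a = antip a'" by (rule antip_surj)
      have "a * right_slice g ?z = right_slice g ((mult_of a \<boxtimes> 1) \<rhd> ?z)"
        by (simp add: right_slice_mult_tensor g)
      also have "\<dots> = right_slice (\<lambda>v. g (a' * v)) ?z"
        unfolding a mult_T1_cointegral[symmetric] by (simp add: right_slice_mult_tensor g)
      finally show ?thesis using slice[OF clinear_comp[OF g clinear_mult_left]] by simp
    qed
    then have "right_slice g ?z \<in> ?X" using K(1) by blast
    then show "g (left_slice f ?z) = 0"
      using f(2) by (simp add: left_slice_functional_right_slice[OF f(1) g])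
  qed
  with f show False using cointegral_slices_separate by blast
qed

lemma left_unit: "\<exists>t. x = t * x" for x :: 'a
  using left_multiples_finite_dim[of x] left_unit_of_finite_dim by blast

lemma left_ideal_double_annihilator:
  assumes I: "left_ideal I"
  shows "left_annihilator (right_annihilator I) = (I :: 'a set)"
proof
  show "I \<subseteq> left_annihilator (right_annihilator I)"
    by (auto simp: left_annihilator_def right_annihilator_def)
  show "left_annihilator (right_annihilator I) \<subseteq> I"
  proof
    fix x assume x: "x \<in> left_annihilator (right_annihilator I)"
    obtain t where t: "x = t * x" using left_unit by blast
    show "x \<in> I"
    proof (rule ccontr)
      assume "x \<notin> I"
      have "cvec.subspace I" using I by (simp add: left_ideal_def)
      then obtain f :: "'a \<Rightarrow> complex" where f: "clinear f" "\<And>w. w \<in> I \<Longrightarrow> f w = 0" "f x \<noteq> 0"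
        using functional_separates_subspace \<open>x \<notin> I\<close> by blast
      \<comment> \<open>With this \<open>g\<close>,
        \<open>g (antip i * antip y) = f (y * i)\<close>, which vanishes for \<open>i\<close> in the
        left ideal \<open>I\<close>.\<close>
      define g where "g y = f (inv antip y)" for y
      have inv [simp]: "inv antip (antip y) = y" for y by (simp add: bij_is_inj[OF bij_antip] inv_f_f)
      have g: "clinear g"
      proof (rule clinearI)
        fix c u v
        obtain u' v' where "u = antip u'" "v = antip v'" by (metis antip_surj)
        then show "g (u + v) = g u + g v" "g (c *\<^sub>C u) = c *\<^sub>C g u"
          by (simp_all add: g_def clinearD[OF antip_linear, symmetric] clinearD[OF f(1)]
              del: scaleC_complex_def)
      qed
      have slice: "left_slice (\<lambda>y. g (antip a * y)) (T1 \<Delta> (h \<otimes> b)) = a * left_slice g (T1 \<Delta> (h \<otimes> b))" for a b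
      proof -
        have "a * left_slice g (T1 \<Delta> (h \<otimes> b)) = left_slice g ((1 \<boxtimes> mult_of a) \<rhd> T1 \<Delta> (h \<otimes> b))"
          by (simp add: left_slice_mult_tensor g)
        then show ?thesis unfolding mult_T1_cointegral by (simp add: left_slice_mult_tensor g)
      qed
      have "left_slice g (T1 \<Delta> (h \<otimes> b)) \<in> right_annihilator I" for b
        unfolding right_annihilator_def
      proof (intro CollectI ballI)
        fix i assume i: "i \<in> I"
        have "g (antip i * y) = 0" for y
        proof -
          obtain y' where y: "y = antip y'" by (rule antip_surj)
          have "y' * i \<in> I" using I i by (simp add: left_ideal_def)
          then show ?thesis using f(2) by (simp add: y antip_mult[symmetric] g_def)
        qed
        then show "i * left_slice g (T1 \<Delta> (h \<otimes> b)) = 0"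
          using slice[of i b, symmetric] by simp
      qed
      then have "left_slice (\<lambda>y. g (antip x * y)) (T1 \<Delta> (h \<otimes> b)) = 0" for b
        using x by (simp add: slice left_annihilator_def)
      \<comment> \<open>Faithfulness yields \<open>f (a * x) = 0\<close> for every \<open>a\<close>;
        evaluating at the local unit \<open>t\<close> gives \<open>f x = 0\<close> itself.\<close>
      then have "g (antip x * antip t) = 0"
        by (rule cointegral_slices_separate[OF clinear_comp[OF g clinear_mult_left]])
      then show False using f(3) t by (simp add: antip_mult[symmetric] g_def)
    qed
  qed
qed

text \<open>The anti-automorphism \<open>antip\<close> interchanges left and right: the preimage of
  \<open>J\<close> is a left ideal, and the image of its right annihilator annihilates
  \<open>J\<close> from the left.\<close>

lemma right_ideal_double_annihilator:
  assumes J: "right_ideal J"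
  shows "right_annihilator (left_annihilator J) = (J :: 'a set)"
proof
  show "J \<subseteq> right_annihilator (left_annihilator J)"
    by (auto simp: left_annihilator_def right_annihilator_def)
  let ?I = "{y. antip y \<in> J}"
  have "left_ideal ?I"
    using J unfolding left_ideal_def right_ideal_def cvec.subspace_def
    by (simp add: clinearD[OF antip_linear] antip_mult)
  then have I: "left_annihilator (right_annihilator ?I) = ?I"
    by (rule left_ideal_double_annihilator)
  show "right_annihilator (left_annihilator J) \<subseteq> J"
  proof
    fix x assume x: "x \<in> right_annihilator (left_annihilator J)"
    obtain y where y: "x = antip y" by (rule antip_surj)
    have antip_zero_iff: "antip u = 0 \<longleftrightarrow> u = 0" for u
      using antip_eq_iff[of u 0] by (simp add: clinearD[OF antip_linear])
    \<comment> \<open>This places \<open>y\<close> in the double annihilator of \<open>?I\<close>: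
      \<open>antip z\<close> lies in the left annihilator of \<open>J\<close>, so
      \<open>antip z * x\<close>, which equals \<open>antip (y * z)\<close>, is zero.\<close>
    have "y * z = 0" if z: "z \<in> right_annihilator ?I" for z
    proof -
      have "antip z * j = 0" if j: "j \<in> J" for j
      proof -
        obtain i where i: "j = antip i" by (rule antip_surj)
        then have "i * z = 0" using z j by (simp add: right_annihilator_def)
        then show ?thesis by (simp add: i antip_mult[symmetric] antip_zero_iff)
      qed
      then have "antip z * x = 0" using x by (simp add: right_annihilator_def left_annihilator_def)
      then show ?thesis by (simp add: y antip_mult[symmetric] antip_zero_iff)
    qed
    then have "y \<in> ?I" using I by (auto simp: left_annihilator_def)
    then show "x \<in> J" by (simp add: y)
  qed
qed

end

end

theorem proposition4p20:
  fixes \<Delta> :: "'a::calgebra \<Rightarrow> ('a \<otimes> 'a) multiplier"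
    and \<epsilon> :: "'a \<Rightarrow> complex"
    and E :: "('a \<otimes> 'a) multiplier"
    and G1 G2 :: "'a \<otimes> 'a \<Rightarrow> 'a \<otimes> 'a"
    and S :: "'a \<Rightarrow> 'a multiplier"
    and h :: 'a
  assumes "regular_weak_multiplier_Hopf_algebra \<Delta> \<epsilon> E G1 G2 S"
    and "faithful_left_cointegral \<Delta> S h"
  shows "quasi_Frobenius TYPE('a)"
proof -
  interpret regular_weak_multiplier_Hopf_algebra \<Delta> \<epsilon> E G1 G2 S by fact
  show ?thesis
    unfolding quasi_Frobenius_def
    using left_ideal_double_annihilator[OF assms(2)] right_ideal_double_annihilator[OF assms(2)]
    by blast
qed

end
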